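(* Suppose the assumptions (A1)–(A5) listed in the context hold, that $\beta>\alpha$, and that $p_n\le 3/4$. Then $$\mathbb{E}\left[\vartheta(\widehat{\mathcal S};\mathcal S)^\beta\,|\,\mathbf{X}\in\mathcal A\right]\le L^{\frac{\beta}{\beta-\alpha}}\left(c_1 n^{-\frac{\alpha}{\beta-\alpha}}+K\sqrt{p_n}\right),$$ where $\widehat{\mathcal S}=\widehat{\mathcal S}_{\mathbf X}$ and $$L=\tau^{-1}\|a\|_{\psi_1},\qquad K=2^{\max(0,\alpha-1)+2}\left(L^{\frac{-\alpha}{\beta-\alpha}}\mathrm{diam}(\mathcal S)^\alpha+c_2\right),$$ $$c_1=\left(\frac{4\beta}{\beta-\alpha}\right)^{\frac{\beta}{\beta-\alpha}},\qquad c_2=2\max\left(\frac{4\alpha}{\beta-\alpha},1\right)^{\frac{\alpha}{\beta-\alpha}}.$$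
   Context: Setting. $(\mathbb{X},\rho,\mu)$ is a metric probability space (Borel $\sigma$-algebra) and $(\mathcal M,\vartheta)$ a metric space. $l:\mathcal M\times\mathbb{X}\to\mathbb{R}$ is such that for every $\phi\in\mathcal M$, $l(\phi,\cdot)$ is measurable and $\mathbb{E}_{X\sim\mu}|l(\phi,X)|<\infty$; $\mathcal R:\mathcal M\to\mathbb{R}\cup\{+\infty\}$. The risk is $\mathcal J(\phi)=\mathbb{E}_{X\sim\mu}[l(\phi,X)]+\mathcal R(\phi)$; for $\mathbf{x}\in\mathbb{X}^n$ the empirical risk is $\widehat{\mathcal J}_{\mathbf x}(\phi)=\frac1n\sum_{i=1}^n l(\phi,x_i)+\mathcal R(\phi)$. $\mathcal S=\arg\min\mathcal J$, $\mathcal J_*=\min\mathcal J$, $\widehat{\mathcal S}_{\mathbf x}=\arg\min\widehat{\mathcal J}_{\mathbf x}$, $\widehat{\mathcal J}_{\mathbf x,*}=\min\widehat{\mathcal J}_{\mathbf x}$. For $\phi\in\mathcal M$ and $E,E'\subseteq\mathcal M$: $\vartheta(\phi,E)=\inf_{\psi\in E}\vartheta(\phi,\psi)$ and $\vartheta(E;E')=\sup_{\phi\in E}\vartheta(\phi,E')$. $[\mathcal J\le c]=\{\phi\in\mathcal M:\mathcal J(\phi)\le c\}$. A pseudometric satisfies the axioms of a metric except $a(x,y)=0\Rightarrow x=y$. $\|Z\|_{\psi_1}=\inf\{c>0:\mathbb{E}\exp(|Z|/c)\le2\}$, and for a pseudometric $a$ on $\mathbb{X}$, $\|a\|_{\psi_1}:=\|a(X,Y)\|_{\psi_1}$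 with $X,Y\sim\mu$ independent. $\mathbf{X}=(X_1,\dots,X_n)$ has i.i.d. components of law $\mu$. Random quantities involved are assumed measurable. Assumptions. (A1) $\mathcal J$ is proper (not identically $+\infty$) and has at least one minimizer; for all $n\ge1$ and $\mu^n$-almost every $\mathbf{x}$, $\widehat{\mathcal J}_{\mathbf x}$ is proper with at least one minimizer, and its minimizers are measurable functions of $\mathbf{x}$. (A2) There are $\mathcal J_0\in(\mathcal J_*,+\infty]$, $\beta\ge1$, $\tau>0$ such that $\phi\in[\mathcal J\le\mathcal J_0]$ implies $\tau\,\vartheta(\phi,\mathcal S)^\beta\le\mathcal J(\phi)-\mathcal J_*$. (A3) There is $\eta:\mathbb{N}\to[0,1]$ with $\lim_{n\to\infty}\eta(n)=0$ and $\mathbb{P}(\sup_{\widehat\phi\in\widehat{\mathcal S}_{\mathbf X}}\mathcal J(\widehat\phi)>\mathcal J_0)\le\eta(n)$. (A4) With $\widehat\tau_{\mathbf x}=\inf_{\mathbf y\in\mathrm{supp}(\mu)^n}\inf\left\{\frac{\widehat{\mathcal J}_{\mathbf x}(\phi)-\widehat{\mathcal J}_{\mathbf x,*}}{\vartheta(\phi,\widehat{\mathcal S}_{\mathbf x})^\beta}:\phi\in[\mathcal J\le\mathcal J_0]\cap\widehat{\mathcal S}_{\mathbf y}\right\}$ (points with $\vartheta(\phi,\widehat{\mathcal S}_{\mathbf x})=0$ disregarded), there is $\kappa:\mathbb{N}\to[0,1]$ with $\lim_{n\to\infty}\kappa(n)=0$ and $\mathbb{P}(\widehat\tau_{\mathbf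 X}<\tau/2)\le\kappa(n)$. (A5) There are $\alpha>0$, a pseudometric $a:\mathbb{X}\times\mathbb{X}\to\mathbb{R}_+$ with $\|a\|_{\psi_1}<\infty$, and $\Upsilon\subseteq\mathcal M$ with $\mathcal S\subseteq\Upsilon$ such that for all $\phi,\psi\in\Upsilon$ and $\mu$-almost every $x,y\in\mathbb{X}$, $l(\phi,x)-l(\psi,x)-l(\phi,y)+l(\psi,y)\le a(x,y)\,\vartheta(\phi,\psi)^\alpha$; moreover there is $\iota:\mathbb{N}\to[0,1]$ with $\lim_{n\to\infty}\iota(n)=0$ and $\mathbb{P}(\widehat{\mathcal S}_{\mathbf X}\not\subset\Upsilon)\le\iota(n)$. The set $\mathcal A\subseteq\mathbb{X}^n$ is $\mathcal A=\{\mathbf{x}:\sup_{\widehat\phi\in\widehat{\mathcal S}_{\mathbf x}}\mathcal J(\widehat\phi)\le\mathcal J_0,\ \widehat\tau_{\mathbf x}\ge\tau/2,\ \widehat{\mathcal S}_{\mathbf x}\subseteq\Upsilon\}$, and $p_n=\mathbb{P}(\mathbf{X}\notin\mathcal A)$.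
   Formalization: In (A5) the exceptional null set of x,y is taken independent of φ,ψ (otherwise the claim fails), and μ is assumed to be carried by supp(μ), which is automatic on separable spaces and is needed for supp(μ) in (A4) to be meaningful. *)

theory Defs
  imports "HOL-Probability.Probability"
begin

text \<open>The risks take values in the reals extended by \<open>+\<infinity>\<close>, hence in \<^typ>\<open>ereal\<close>; suprema of distances
  and the diameter may be infinite, hence live in \<^typ>\<open>ennreal\<close>.\<close>

definition minimizers :: "('m \<Rightarrow> ereal) \<Rightarrow> 'm set" where
  "minimizers J = {\<phi>. is_arg_min J (\<lambda>_. True) \<phi>}"

text \<open>An infimum, which is the minimum as soon as \<open>minimizers J \<noteq> {}\<close>.\<close>

definition min_value :: "('m \<Rightarrow> ereal) \<Rightarrow> ereal" where
  "min_value J = (INF \<phi>. J \<phi>)"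

definition proper :: "('m \<Rightarrow> ereal) \<Rightarrow> bool" where
  "proper J \<longleftrightarrow> (\<exists>\<phi>. J \<phi> \<noteq> \<infinity>)"

definition risk :: "'x measure \<Rightarrow> ('m \<Rightarrow> 'x \<Rightarrow> real) \<Rightarrow> ('m \<Rightarrow> ereal) \<Rightarrow> 'm \<Rightarrow> ereal" where
  "risk \<mu> l R \<phi> = ereal (\<integral>x. l \<phi> x \<partial>\<mu>) + R \<phi>"

text \<open>A sample of size \<open>n\<close> is a function on the indices \<open>{..<n}\<close>, and \<open>sample \<mu> n\<close> is the law
  of \<open>n\<close> independent observations of law \<open>\<mu>\<close>.\<close>

definition emp_risk :: "('m \<Rightarrow> 'x \<Rightarrow> real) \<Rightarrow> ('m \<Rightarrow> ereal) \<Rightarrow> nat \<Rightarrow> (nat \<Rightarrow> 'x) \<Rightarrow> 'm \<Rightarrow> ereal" where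
  "emp_risk l R n x \<phi> = ereal (1 / real n * (\<Sum>i<n. l \<phi> (x i))) + R \<phi>"

definition sample :: "'x measure \<Rightarrow> nat \<Rightarrow> (nat \<Rightarrow> 'x) measure" where
  "sample \<mu> n = (\<Pi>\<^sub>M i\<in>{..<n}. \<mu>)"

definition excess_dist :: "'m::metric_space set \<Rightarrow> 'm set \<Rightarrow> ennreal" where
  "excess_dist E E' = (SUP \<phi>\<in>E. ennreal (infdist \<phi> E'))"

text \<open>Unlike the library's real-valued \<^const>\<open>diameter\<close>, this is \<open>\<infinity>\<close> on unbounded sets.\<close>

definition ediameter :: "'m::metric_space set \<Rightarrow> ennreal" where
  "ediameter E = (SUP \<phi>\<in>E. SUP \<psi>\<in>E. ennreal (dist \<phi> \<psi>))"

text \<open>Only used with a positive exponent.\<close>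

definition ennreal_powr :: "ennreal \<Rightarrow> real \<Rightarrow> ennreal" where
  "ennreal_powr u p = (if u = \<infinity> then \<infinity> else ennreal (enn2real u powr p))"

definition psi1_norm :: "'w measure \<Rightarrow> ('w \<Rightarrow> real) \<Rightarrow> ennreal" where
  "psi1_norm M Z = (INF c\<in>{c::real. c > 0 \<and> (\<integral>\<^sup>+ w. ennreal (exp (\<bar>Z w\<bar> / c)) \<partial>M) \<le> 2}. ennreal c)"

definition pseudometric :: "('x \<Rightarrow> 'x \<Rightarrow> real) \<Rightarrow> bool" where
  "pseudometric a \<longleftrightarrow> (\<forall>x y. 0 \<le> a x y) \<and> (\<forall>x. a x x = 0) \<and> (\<forall>x y. a x y = a y x)
     \<and> (\<forall>x y z. a x z \<le> a x y + a y z)"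

definition measure_support :: "'x::topological_space measure \<Rightarrow> 'x set" where
  "measure_support \<mu> = {x. \<forall>U. open U \<and> x \<in> U \<longrightarrow> emeasure \<mu> U > 0}"

text \<open>The infimum over an empty family is \<open>\<infinity>\<close>. For \<open>\<mu>\<close> a probability measure, null sets of samples
  without minimizer are irrelevant, so the value \<open>infdist \<phi> {} = 0\<close> has no effect.\<close>

definition tau_hat ::
  "'x::topological_space measure \<Rightarrow> ('m::metric_space \<Rightarrow> 'x \<Rightarrow> real) \<Rightarrow> ('m \<Rightarrow> ereal) \<Rightarrow> real \<Rightarrow> ereal
     \<Rightarrow> nat \<Rightarrow> (nat \<Rightarrow> 'x) \<Rightarrow> ereal" where
  "tau_hat \<mu> l R \<beta> J0 n x =
     (INF y \<in> {..<n} \<rightarrow>\<^sub>E measure_support \<mu>.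
      INF \<phi> \<in> {\<phi>. risk \<mu> l R \<phi> \<le> J0 \<and> \<phi> \<in> minimizers (emp_risk l R n y)
                 \<and> infdist \<phi> (minimizers (emp_risk l R n x)) \<noteq> 0}.
        (emp_risk l R n x \<phi> - min_value (emp_risk l R n x))
          / ereal (infdist \<phi> (minimizers (emp_risk l R n x)) powr \<beta>))"

definition good_set ::
  "'x::topological_space measure \<Rightarrow> ('m::metric_space \<Rightarrow> 'x \<Rightarrow> real) \<Rightarrow> ('m \<Rightarrow> ereal) \<Rightarrow> real \<Rightarrow> real
     \<Rightarrow> ereal \<Rightarrow> 'm set \<Rightarrow> nat \<Rightarrow> (nat \<Rightarrow> 'x) set" where
  "good_set \<mu> l R \<tau> \<beta> J0 \<Upsilon> n =
     {x \<in> space (sample \<mu> n).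
        (SUP \<phi>\<in>minimizers (emp_risk l R n x). risk \<mu> l R \<phi>) \<le> J0
      \<and> tau_hat \<mu> l R \<beta> J0 n x \<ge> ereal (\<tau> / 2)
      \<and> minimizers (emp_risk l R n x) \<subseteq> \<Upsilon>}"

text \<open>A Borel measure on a separable metric space is carried by its support. On a non-separable
  space this is not provable (real-valued measurable cardinals), which is why a statement about
  arbitrary metric spaces and involving the support has to require it.\<close>

lemma AE_measure_support:
  fixes \<mu> :: "'x::{metric_space, second_countable_topology} measure"
  assumes "sets \<mu> = sets borel"
  shows "AE x in \<mu>. x \<in> measure_support \<mu>"
proof -
  obtain B :: "'x set set" where B: "countable B" "\<And>C. C \<in> B \<Longrightarrow> open C"
    "\<And>S. open S \<Longrightarrow> \<exists>U. U \<subseteq> B \<and> S = \<Union>U"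
    by (metis univ_second_countable)
  define N where "N = \<Union>{C \<in> B. emeasure \<mu> C = 0}"
  have "N \<in> null_sets \<mu>"
    unfolding N_def using B assms
    by (intro null_sets_UN'[where N = "\<lambda>C. C", simplified]) (auto intro: null_setsI countable_subset)
  moreover have "{x \<in> space \<mu>. x \<notin> measure_support \<mu>} \<subseteq> N"
  proof
    fix x assume "x \<in> {x \<in> space \<mu>. x \<notin> measure_support \<mu>}"
    then obtain U where U: "open U" "x \<in> U" "emeasure \<mu> U = 0"
      by (auto simp: measure_support_def not_gr_zero)
    obtain C where "C \<in> B" "x \<in> C" "C \<subseteq> U"
      using B(3)[OF U(1)] U(2) by blast
    moreover have "emeasure \<mu> C = 0"
      using emeasure_mono[of C U \<mu>] U assms \<open>C \<subseteq> U\<close> by auto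
    ultimately show "x \<in> N" by (auto simp: N_def)
  qed
  ultimately show ?thesis by (rule AE_I'[rotated 0])
qed

end

theory Submission
  imports Defs
begin

text \<open>Write \<open>s = \<alpha> / (\<beta> - \<alpha>)\<close>, fix a minimizer \<open>\<psi>\<close> of the risk and let \<open>W\<close> be \<open>n\<close> times the difference
  between the minimal empirical risk and the empirical risk of \<open>\<psi>\<close>. For a sample \<open>x\<close> in the good set
  and an empirical minimizer \<open>\<phi>\<close>, the margin condition bounds \<open>\<tau> \<vartheta>(\<phi>, S)\<^sup>\<beta>\<close> by the average over \<open>i\<close>
  of the mean over \<open>y\<close> of the increments of \<open>l \<phi> - l \<psi>\<close> from \<open>x\<^sub>i\<close> to \<open>y\<close>. Let \<open>x'\<close> be \<open>x\<close> with its \<open>i\<close>-th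
  observation replaced by \<open>y\<close>. If \<open>x'\<close> is good as well, the increment is at most \<open>W x' - W x\<close> plus a
  stability term of order \<open>n powr (- s) * a(x\<^sub>i, y) powr (1 + s)\<close>; the difference is antisymmetric under the
  exchange of \<open>x\<^sub>i\<close> and \<open>y\<close>, so its mean vanishes. If \<open>x'\<close> is not good, an event of probability at most
  \<open>p\<close>, the increment is at most \<open>a(x\<^sub>i, y) \<vartheta>(\<phi>, \<psi>)\<^sup>\<alpha>\<close>, which the Cauchy-Schwarz inequality and the
  exponential moment of \<open>a\<close> control.\<close>

section \<open>Elementary inequalities\<close>

text \<open>For \<open>\<alpha> \<le> 1\<close> both fractions \<open>u / (u + v)\<close> and
  \<open>v / (u + v)\<close> lie in the unit interval, are dominated by their
  \<open>\<alpha>\<close>-th powers and sum to 1, so the power is subadditive. For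
  \<open>\<alpha> > 1\<close> the factor comes from convexity at the midpoint.\<close>

lemma powr_add_le_max:
  fixes u v \<alpha> :: real
  assumes "0 \<le> u" "0 \<le> v" "0 < \<alpha>"
  shows "(u + v) powr \<alpha> \<le> 2 powr max 0 (\<alpha> - 1) * (u powr \<alpha> + v powr \<alpha>)"
proof (cases "\<alpha> \<le> 1")
  case True
  show ?thesis
  proof (cases "u + v = 0")
    case False
    then have pos: "u + v > 0" using assms by linarith
    have frac: "w powr \<alpha> \<ge> (u + v) powr \<alpha> * (w / (u + v))" if "0 \<le> w" "w \<le> u + v" for w
    proof -
      have "(w / (u + v)) powr 1 \<le> (w / (u + v)) powr \<alpha>"
        using that pos True by (intro powr_mono') (auto simp: divide_le_eq_1)
      then have "w / (u + v) \<le> w powr \<alpha> / (u + v) powr \<alpha>"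
        using that pos by (simp add: powr_divide)
      then show ?thesis
        using pos by (simp add: field_simps)
    qed
    have "(u + v) powr \<alpha> = (u + v) powr \<alpha> * (u / (u + v)) + (u + v) powr \<alpha> * (v / (u + v))"
      using pos by (simp only: distrib_left[symmetric] add_divide_distrib[symmetric]) simp
    also have "\<dots> \<le> u powr \<alpha> + v powr \<alpha>"
      using assms by (intro add_mono frac) auto
    finally show ?thesis using True by simp
  qed (use assms in auto)
next
  case False
  \<comment> \<open>Convexity of the power is applied on the open half-line, so a vanishing argument
    is treated apart.\<close>
  show ?thesis
  proof (cases "u = 0 \<or> v = 0")
    case True
    have "1 * w \<le> 2 powr (\<alpha> - 1) * w" if "0 \<le> w" for w :: real
      using that False by (intro mult_right_mono ge_one_powr_ge_zero) auto
    from this[of "u powr \<alpha>"] this[of "v powr \<alpha>"] show ?thesis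
      using True False assms by auto
  next
    case uv: False
    have "((1 - 1/2) *\<^sub>R u + (1/2) *\<^sub>R v) powr \<alpha> \<le> (1 - 1/2) * u powr \<alpha> + (1/2) * v powr \<alpha>"
      using powr_convex[of \<alpha>] assms False uv by (intro convex_onD[of "{0<..}"]) auto
    then have "((u + v) / 2) powr \<alpha> \<le> (u powr \<alpha> + v powr \<alpha>) / 2"
      by (simp add: field_simps)
    then have "(u + v) powr \<alpha> \<le> 2 powr \<alpha> * ((u powr \<alpha> + v powr \<alpha>) / 2)"
      using assms by (simp add: powr_divide field_simps)
    also have "\<dots> = 2 powr (\<alpha> - 1) * (u powr \<alpha> + v powr \<alpha>)"
      by (simp add: powr_diff)
  finally show ?thesis using False by simp
  qed
qed

section \<open>Powers bounded by exponentials\<close>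

text \<open>The remainder of the exponential series after four terms has only nonnegative
  terms.\<close>

lemma exp_ge_cubic:
  fixes t :: real
  assumes "0 \<le> t"
  shows "1 + t + t\<^sup>2 / 2 + t ^ 3 / 6 \<le> exp t"
proof -
  have "0 \<le> (\<Sum>k. t ^ (k + 4) /\<^sub>R fact (k + 4))"
    using assms summable_exp_generic[of t] summable_iff_shift[of "\<lambda>k. t ^ k /\<^sub>R fact k" 4]
    by (intro suminf_nonneg) simp_all
  then show ?thesis
    using exp_first_terms[of t 4] by (simp add: eval_nat_numeral field_simps)
qed

text \<open>The cubic bound leaves \<open>t\<close> times a quadratic, positive after completing the
  square. The \<open>- 1\<close> is what turns an exponential moment at most 2 into a second moment
  with constant exactly 1.\<close>

lemma square_le_exp_minus_one:
  fixes t :: real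
  assumes "0 \<le> t"
  shows "t\<^sup>2 \<le> exp t - 1"
proof -
  have "0 \<le> t * ((t - 3/2)\<^sup>2 / 6 + 5/8)"
    using assms by (intro mult_nonneg_nonneg add_nonneg_nonneg) auto
  also have "t * ((t - 3/2)\<^sup>2 / 6 + 5/8) = t + t\<^sup>2 / 2 + t ^ 3 / 6 - t\<^sup>2"
    by (simp add: power2_eq_square power3_eq_cube field_simps)
  finally show ?thesis using exp_ge_cubic[OF assms] by linarith
qed

text \<open>The exponent 3/4 leaves the weight 1/4 for the second factor in
  \<open>square_powr_le_exp_mix\<close>.\<close>

lemma square_le_two_exp:
  fixes t :: real
  assumes "0 \<le> t"
  shows "t\<^sup>2 \<le> 2 * exp (3 / 4 * t)"
proof -
  define v where "v = 3 / 4 * t"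
  have v: "0 \<le> v" using assms by (simp add: v_def)
  \<comment> \<open>Completed square of \<open>2 - 7/9 * v + v^2 / 3\<close>, which is what remains
    of the cubic bound after subtracting \<open>16/9 * v^2\<close> and splitting off the constant
    and a factor \<open>v\<close>.\<close>
  have "0 \<le> 2 + v * ((v - 7/6)\<^sup>2 / 3 + 167/108)"
    using v by (intro add_nonneg_nonneg mult_nonneg_nonneg) auto
  also have "\<dots> = 2 * (1 + v + v\<^sup>2 / 2 + v ^ 3 / 6) - 16/9 * v\<^sup>2"
    by (simp add: power2_eq_square power3_eq_cube field_simps)
  finally have "16/9 * v\<^sup>2 \<le> 2 * (1 + v + v\<^sup>2 / 2 + v ^ 3 / 6)" by simp
  also have "\<dots> \<le> 2 * exp v"
    using exp_ge_cubic[OF v] by (intro mult_left_mono) auto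
  finally have "16/9 * v\<^sup>2 \<le> 2 * exp v" .
  then show ?thesis by (simp add: v_def power_mult_distrib power2_eq_square)
qed

text \<open>The function \<open>t powr r * exp (- t)\<close> is maximal at \<open>t = r\<close>;
  this is \<open>ln z \<le> z - 1\<close> at \<open>z = t / r\<close>.\<close>

lemma powr_le_exp:
  fixes t r :: real
  assumes "0 \<le> t" "0 < r"
  shows "t powr r \<le> r powr r * exp (- r) * exp t"
proof (cases "t = 0")
  case False
  then have t: "0 < t" using assms by simp
  have "r * (ln t - ln r) \<le> r * (t / r - 1)"
    using ln_le_minus_one[of "t / r"] t assms by (intro mult_left_mono) (auto simp: ln_div)
  then have "r * ln t \<le> r * ln r - r + t"
    using assms by (simp add: right_diff_distrib)
  then have "exp (r * ln t) \<le> exp (r * ln r - r + t)"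
    by simp
  then show ?thesis
    using t assms by (simp add: powr_def exp_add exp_diff exp_minus field_simps)
qed (use assms in auto)

text \<open>Each factor is bounded by an exponential, and convexity of \<open>exp\<close> with
  weights 3/4 and 1/4 replaces the product by a sum. A sum can be integrated term by term, so
  \<open>t\<close> and \<open>u\<close> may later be dependent random variables.\<close>

lemma square_powr_le_exp_mix:
  fixes t u s M :: real
  assumes t: "0 \<le> t" and u: "0 \<le> u" and s: "0 < s" and M: "1 \<le> M" "4 * s \<le> M"
  shows "t\<^sup>2 * u powr (2 * s) \<le> 2 * M powr (2 * s) * (3 / 4 * exp t + 1 / 4 * exp u)"
proof -
  have upow: "u powr (2 * s) \<le> M powr (2 * s) * exp (u / 4)"
  proof (cases "u = 0")
    case False
    then have u0: "0 < u" using u by simp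
    \<comment> \<open>The tangent of \<open>ln\<close> is taken at \<open>2 * M\<close> so that its
      constant -1 absorbs \<open>ln 2\<close>; the slope then becomes 1/4 through
      \<open>4 * s \<le> M\<close>.\<close>
    have "ln (u / (2 * M)) \<le> u / (2 * M) - 1"
      using u0 M by (intro ln_le_minus_one) auto
    moreover have "ln (2::real) \<le> 1"
      using ln_le_minus_one[of "2::real"] by simp
    ultimately have "ln u - ln M \<le> u / (2 * M)"
      using u0 M by (simp add: ln_div ln_mult)
    then have "2 * s * (ln u - ln M) \<le> 2 * s * (u / (2 * M))"
      using s by (intro mult_left_mono) auto
    also have "\<dots> = (4 * s) * (u / (4 * M))" by simp
    also have "\<dots> \<le> M * (u / (4 * M))"
      using M u0 by (intro mult_right_mono) auto
    finally have "2 * s * ln u \<le> 2 * s * ln M + u / 4"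
      using M by (simp add: algebra_simps)
    then have "exp (2 * s * ln u) \<le> exp (2 * s * ln M + u / 4)"
      by simp
    then show ?thesis
      using u0 M by (simp add: powr_def exp_add)
  qed (use s in auto)
  have "exp ((1 - 1/4) *\<^sub>R t + (1/4) *\<^sub>R u) \<le> (1 - 1/4) * exp t + (1/4) * exp u"
    by (rule convex_onD[OF exp_convex]) auto
  then have conv: "exp (3/4 * t) * exp (u / 4) \<le> 3/4 * exp t + 1/4 * exp u"
    by (simp add: exp_add[symmetric])
  have "t\<^sup>2 * u powr (2 * s) \<le> (2 * exp (3/4 * t)) * (M powr (2 * s) * exp (u / 4))"
    using square_le_two_exp[OF t] upow by (intro mult_mono) auto
  also have "\<dots> = 2 * M powr (2 * s) * (exp (3/4 * t) * exp (u / 4))"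
    by simp
  also have "\<dots> \<le> 2 * M powr (2 * s) * (3/4 * exp t + 1/4 * exp u)"
    using conv by (intro mult_left_mono) auto
  finally show ?thesis .
qed

text \<open>Dividing by \<open>d powr \<alpha>\<close> isolates
  \<open>d powr (\<beta> - \<alpha>)\<close>. This step turns a self-bounding inequality for a
  distance into an absolute bound; it serves both for the distance to \<open>S\<close> and for the
  distance to the minimizers of a modified sample.\<close>

lemma powr_bound_of_powr_le:
  fixes d b g \<alpha> \<beta> :: real
  assumes d: "0 \<le> d" and b: "0 < b" and g: "0 \<le> g" and ab: "0 < \<alpha>" "\<alpha> < \<beta>"
    and le: "b * d powr \<beta> \<le> g * d powr \<alpha>"
  shows "d powr \<alpha> \<le> (g / b) powr (\<alpha> / (\<beta> - \<alpha>))"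
proof (cases "d = 0")
  case False
  then have d0: "0 < d" using d by simp
  have "b * d powr (\<beta> - \<alpha>) \<le> g"
    using le d0 by (simp add: powr_diff field_simps)
  then have "d powr (\<beta> - \<alpha>) \<le> g / b"
    using b by (simp add: field_simps)
  then have "(d powr (\<beta> - \<alpha>)) powr (\<alpha> / (\<beta> - \<alpha>)) \<le> (g / b) powr (\<alpha> / (\<beta> - \<alpha>))"
    using ab by (intro powr_mono2) auto
  then show ?thesis
    using ab by (simp add: powr_powr)
qed (use ab in auto)

section \<open>Distances to sets\<close>

text \<open>A nearest point of \<open>T\<close> need not exist. Every radius above
  \<open>infdist \<phi> T\<close> is reached by some point of \<open>T\<close>, and the radius is
  then sent to \<open>infdist \<phi> T\<close> from the right.\<close>

lemma le_mult_infdist_powr: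
  fixes v g \<alpha> :: real and \<phi> :: "'m::metric_space"
  assumes T: "T \<noteq> {}" and \<alpha>: "0 < \<alpha>" and g: "0 \<le> g"
    and le: "\<And>\<psi>. \<psi> \<in> T \<Longrightarrow> v \<le> g * dist \<phi> \<psi> powr \<alpha>"
  shows "v \<le> g * infdist \<phi> T powr \<alpha>"
proof -
  have le': "v \<le> g * r powr \<alpha>" if r: "infdist \<phi> T < r" for r
  proof -
    obtain \<psi> where \<psi>: "\<psi> \<in> T" "dist \<phi> \<psi> < r"
      using r T cINF_less_iff[of T "dist \<phi>" r] bdd_belowI2[of T 0 "dist \<phi>"]
      by (auto simp: infdist_notempty)
    have "g * dist \<phi> \<psi> powr \<alpha> \<le> g * r powr \<alpha>"
      using \<psi>(2) \<alpha> g by (intro mult_left_mono powr_mono2) auto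
    then show ?thesis using le[OF \<psi>(1)] by linarith
  qed
  have "((\<lambda>r. g * r powr \<alpha>) \<longlongrightarrow> g * infdist \<phi> T powr \<alpha>) (at_right (infdist \<phi> T))"
    using \<alpha> by (intro tendsto_intros) (auto simp: eventually_at_filter infdist_nonneg intro!: always_eventually order.trans[OF infdist_nonneg])
  then show ?thesis
    by (rule tendsto_lowerbound)
       (auto simp: eventually_at_filter le' intro!: always_eventually)
qed

text \<open>Triangle inequality through an arbitrary point of \<open>T\<close>, followed by the
  infimum over that point.\<close>

lemma dist_le_infdist_add_ediameter:
  fixes \<phi> :: "'m::metric_space"
  assumes "\<psi> \<in> T"
  shows "ennreal (dist \<phi> \<psi>) \<le> ennreal (infdist \<phi> T) + ediameter T"
proof (cases "ediameter T")
  case (real D)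
  have T: "T \<noteq> {}" using assms by auto
  have "dist \<phi> \<psi> - D \<le> infdist \<phi> T"
    unfolding infdist_notempty[OF T]
  proof (rule cINF_greatest)
    fix \<xi> assume "\<xi> \<in> T"
    then have "ennreal (dist \<xi> \<psi>) \<le> ediameter T"
      using assms unfolding ediameter_def by (auto intro: SUP_upper2)
    then have "dist \<xi> \<psi> \<le> D" using real by simp
    then show "dist \<phi> \<psi> - D \<le> dist \<phi> \<xi>"
      using dist_triangle[of \<phi> \<psi> \<xi>] by linarith
  qed (use assms in auto)
  then show ?thesis
    using real by (simp add: ennreal_plus[symmetric] infdist_nonneg ennreal_leI del: ennreal_plus)
qed simp

text \<open>Source of the factor \<open>2 powr max 0 (\<alpha> - 1)\<close> and of the diameter in
  \<open>K\<close>: the distance to a fixed risk minimizer is traded for the distance to the set of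
  all of them.\<close>

lemma ennreal_dist_powr_le:
  fixes \<phi> :: "'m::metric_space"
  assumes "\<psi> \<in> T" "0 < \<alpha>"
  shows "ennreal (dist \<phi> \<psi> powr \<alpha>)
    \<le> ennreal (2 powr max 0 (\<alpha> - 1)) * (ennreal (infdist \<phi> T powr \<alpha>) + ennreal_powr (ediameter T) \<alpha>)"
proof (cases "ediameter T")
  case (real D)
  have "ennreal (dist \<phi> \<psi>) \<le> ennreal (infdist \<phi> T + D)"
    using dist_le_infdist_add_ediameter[OF assms(1), of \<phi>] real by (simp add: infdist_nonneg)
  then have "dist \<phi> \<psi> \<le> infdist \<phi> T + D"
    using real by (subst (asm) ennreal_le_iff) (auto simp: infdist_nonneg)
  then have "dist \<phi> \<psi> powr \<alpha> \<le> (infdist \<phi> T + D) powr \<alpha>"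
    using assms by (intro powr_mono2) auto
  also have "\<dots> \<le> 2 powr max 0 (\<alpha> - 1) * (infdist \<phi> T powr \<alpha> + D powr \<alpha>)"
    using real assms by (intro powr_add_le_max) (auto simp: infdist_nonneg)
  finally have "ennreal (dist \<phi> \<psi> powr \<alpha>)
      \<le> ennreal (2 powr max 0 (\<alpha> - 1) * (infdist \<phi> T powr \<alpha> + D powr \<alpha>))"
    by (rule ennreal_leI)
  then show ?thesis
    using real by (simp add: ennreal_powr_def ennreal_mult'')
next
  case top
  then show ?thesis by (simp add: ennreal_powr_def ennreal_mult_top)
qed

text \<open>The root of order \<open>\<beta>\<close> turns the assumption into a common bound on the
  distances themselves; the supremum is taken there and the power restored afterwards.\<close>

lemma ennreal_powr_excess_dist_le:
  assumes "0 < \<beta>" and le: "\<And>\<phi>. \<phi> \<in> E \<Longrightarrow> ennreal (infdist \<phi> T powr \<beta>) \<le> C"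
  shows "ennreal_powr (excess_dist E T) \<beta> \<le> C"
proof (cases C)
  case (real c)
  have "infdist \<phi> T \<le> c powr (1 / \<beta>)" if "\<phi> \<in> E" for \<phi>
  proof -
    have "infdist \<phi> T powr \<beta> \<le> c"
      using le[OF that] real by simp
    then have "(infdist \<phi> T powr \<beta>) powr (1 / \<beta>) \<le> c powr (1 / \<beta>)"
      using assms(1) by (intro powr_mono2) auto
    then show ?thesis
      using assms(1) by (simp add: powr_powr infdist_nonneg)
  qed
  then have ex: "excess_dist E T \<le> ennreal (c powr (1 / \<beta>))"
    unfolding excess_dist_def by (intro SUP_least ennreal_leI) auto
  then have fin: "excess_dist E T \<noteq> \<infinity>"
    by (auto simp: top_unique)
  have "enn2real (excess_dist E T) \<le> c powr (1 / \<beta>)"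
    using ex by (intro enn2real_leI) auto
  then have "enn2real (excess_dist E T) powr \<beta> \<le> (c powr (1 / \<beta>)) powr \<beta>"
    using assms(1) by (intro powr_mono2) auto
  also have "\<dots> = c" using assms(1) real by (simp add: powr_powr)
  finally show ?thesis
    using real fin by (simp add: ennreal_powr_def ennreal_leI)
qed simp

section \<open>Exponential moments from the psi_1 norm\<close>

lemma psi1_norm_witness:
  assumes "psi1_norm M Z < ennreal c"
  obtains c' where "0 < c'" "c' < c" "(\<integral>\<^sup>+ w. ennreal (exp (\<bar>Z w\<bar> / c')) \<partial>M) \<le> 2"
  using assms unfolding psi1_norm_def INF_less_iff
  by (auto simp: ennreal_less_iff)

lemma nn_integral_exp_psi1_le:
  assumes "psi1_norm M Z < ennreal c"
  shows "(\<integral>\<^sup>+ w. ennreal (exp (\<bar>Z w\<bar> / c)) \<partial>M) \<le> 2"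
proof -
  obtain c' where c': "0 < c'" "c' < c" "(\<integral>\<^sup>+ w. ennreal (exp (\<bar>Z w\<bar> / c')) \<partial>M) \<le> 2"
    using psi1_norm_witness[OF assms] .
  have "(\<integral>\<^sup>+ w. ennreal (exp (\<bar>Z w\<bar> / c)) \<partial>M) \<le> (\<integral>\<^sup>+ w. ennreal (exp (\<bar>Z w\<bar> / c')) \<partial>M)"
    using c' by (intro nn_integral_mono ennreal_leI) (auto intro!: divide_left_mono)
  then show ?thesis using c'(3) by (rule order.trans)
qed

text \<open>The infimum defining a positive norm is attained: Fatou's lemma along admissible
  constants \<open>c k\<close> decreasing to \<open>N\<close>. A vanishing norm is the subject of
  \<open>psi1_norm_eq_0_AE\<close>.\<close>

lemma nn_integral_exp_psi1_norm_le:
  assumes Z[measurable]: "Z \<in> borel_measurable M" and N: "psi1_norm M Z = ennreal N" "0 < N"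
  shows "(\<integral>\<^sup>+ w. ennreal (exp (\<bar>Z w\<bar> / N)) \<partial>M) \<le> 2"
proof -
  define c where "c k = N + 1 / real (Suc k)" for k
  have c: "N < c k" for k by (simp add: c_def)
  have lim: "c \<longlonglongrightarrow> N"
    unfolding c_def using tendsto_add[OF tendsto_const LIMSEQ_inverse_real_of_nat, of N]
    by (simp add: inverse_eq_divide)
  have "(\<integral>\<^sup>+ w. ennreal (exp (\<bar>Z w\<bar> / N)) \<partial>M)
      = (\<integral>\<^sup>+ w. liminf (\<lambda>k. ennreal (exp (\<bar>Z w\<bar> / c k))) \<partial>M)"
  proof (intro nn_integral_cong)
    fix w
    have "(\<lambda>k. ennreal (exp (\<bar>Z w\<bar> / c k))) \<longlonglongrightarrow> ennreal (exp (\<bar>Z w\<bar> / N))"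
      using lim N by (intro tendsto_intros) auto
    then show "ennreal (exp (\<bar>Z w\<bar> / N)) = liminf (\<lambda>k. ennreal (exp (\<bar>Z w\<bar> / c k)))"
      by (intro lim_imp_Liminf[symmetric]) auto
  qed
  also have "\<dots> \<le> liminf (\<lambda>k. \<integral>\<^sup>+ w. ennreal (exp (\<bar>Z w\<bar> / c k)) \<partial>M)"
    by (intro nn_integral_liminf) auto
  also have "\<dots> \<le> liminf (\<lambda>k. 2)"
    using c N by (intro Liminf_mono always_eventually allI nn_integral_exp_psi1_le) (auto simp: ennreal_less_iff)
  also have "\<dots> = 2"
    by (simp add: Liminf_const)
  finally show ?thesis .
qed

lemma nn_integral_abs_le_exp_moment:
  assumes Z[measurable]: "Z \<in> borel_measurable M" and c: "0 < c"
    and exp: "(\<integral>\<^sup>+ w. ennreal (exp (\<bar>Z w\<bar> / c)) \<partial>M) \<le> 2"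
  shows "(\<integral>\<^sup>+ w. ennreal \<bar>Z w\<bar> \<partial>M) \<le> ennreal (2 * c)"
proof -
  have "(\<integral>\<^sup>+ w. ennreal \<bar>Z w\<bar> \<partial>M) \<le> (\<integral>\<^sup>+ w. ennreal c * ennreal (exp (\<bar>Z w\<bar> / c)) \<partial>M)"
  proof (rule nn_integral_mono)
    fix w
    have "\<bar>Z w\<bar> / c \<le> exp (\<bar>Z w\<bar> / c)"
      using exp_ge_add_one_self[of "\<bar>Z w\<bar> / c"] by linarith
    then have "\<bar>Z w\<bar> \<le> c * exp (\<bar>Z w\<bar> / c)"
      using c by (simp add: field_simps)
    then show "ennreal \<bar>Z w\<bar> \<le> ennreal c * ennreal (exp (\<bar>Z w\<bar> / c))"
      using c by (simp add: ennreal_mult[symmetric] ennreal_leI)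
  qed
  also have "\<dots> \<le> ennreal c * 2"
    using exp by (subst nn_integral_cmult) (auto intro!: mult_left_mono)
  finally show ?thesis using c by (simp add: ennreal_mult'' mult.commute)
qed

text \<open>Every \<open>c > 0\<close> is admissible, hence the first absolute moment is at most
  \<open>2 * c\<close> for all of them.\<close>

lemma psi1_norm_eq_0_AE:
  assumes Z[measurable]: "Z \<in> borel_measurable M" and N: "psi1_norm M Z = 0"
  shows "AE w in M. Z w = 0"
proof -
  have "(\<integral>\<^sup>+ w. ennreal \<bar>Z w\<bar> \<partial>M) \<le> ennreal (2 * c)" if c: "0 < c" for c
    using nn_integral_exp_psi1_le[of M Z c] N c by (intro nn_integral_abs_le_exp_moment) auto
  then have "(\<integral>\<^sup>+ w. ennreal \<bar>Z w\<bar> \<partial>M) \<le> ennreal e" if "0 < e" for e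
    using that[THEN half_gt_zero] by fastforce
  then have "(\<integral>\<^sup>+ w. ennreal \<bar>Z w\<bar> \<partial>M) \<le> 0"
    by - (rule ennreal_le_epsilon, auto)
  then have "AE w in M. ennreal \<bar>Z w\<bar> = 0"
    by (subst nn_integral_0_iff_AE[symmetric]) auto
  then show ?thesis by eventually_elim auto
qed

section \<open>Resampling one observation\<close>

lemma (in prob_space) prob_space_sample: "prob_space (sample M n)"
  unfolding sample_def by (intro prob_space_PiM) unfold_locales

lemma measurable_sample_component:
  "i < n \<Longrightarrow> (\<lambda>x. x i) \<in> sample M n \<rightarrow>\<^sub>M M"
  unfolding sample_def by (intro measurable_component_singleton) auto

lemma space_sample: "space (sample M n) = {..<n} \<rightarrow>\<^sub>E space M"
  unfolding sample_def by (simp add: space_PiM)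

lemma measurable_sample_update:
  assumes "i < n"
  shows "(\<lambda>(x, y). x(i := y)) \<in> sample M n \<Otimes>\<^sub>M M \<rightarrow>\<^sub>M sample M n"
proof -
  have "(\<lambda>(f, y). f(i := y)) \<in> (sample M n \<Otimes>\<^sub>M M) \<rightarrow>\<^sub>M Pi\<^sub>M (insert i {..<n}) (\<lambda>_. M)"
    unfolding sample_def by (rule measurable_add_dim)
  moreover have "insert i {..<n} = {..<n}" using assms by auto
  ultimately show ?thesis by (metis sample_def)
qed

text \<open>The replaced observation is kept as the second component. The replacement thereby
  becomes an exchange of two independent observations, under which a difference of values on the old
  and the new sample changes sign.\<close>

definition resample_swap :: "nat \<Rightarrow> (nat \<Rightarrow> 'x) \<times> 'x \<Rightarrow> (nat \<Rightarrow> 'x) \<times> 'x" where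
  "resample_swap i = (\<lambda>(x, y). (x(i := y), x i))"

lemma measurable_resample_swap [measurable]:
  assumes [simp]: "i < n"
  shows "resample_swap i \<in> sample M n \<Otimes>\<^sub>M M \<rightarrow>\<^sub>M sample M n \<Otimes>\<^sub>M M"
proof -
  have "(\<lambda>w. (case w of (x, y) \<Rightarrow> x(i := y), fst w i)) \<in> sample M n \<Otimes>\<^sub>M M \<rightarrow>\<^sub>M sample M n \<Otimes>\<^sub>M M"
    by (rule measurable_Pair[OF measurable_sample_update[OF assms]
          measurable_compose[OF measurable_fst measurable_sample_component[OF assms]]])
  then show ?thesis
    by (simp add: resample_swap_def split_beta')
qed

text \<open>Splitting off coordinate \<open>i\<close> writes the integral as an iterated one over
  the other coordinates, the old observation \<open>u\<close> and the fresh one \<open>y\<close>.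
  The map only exchanges the last two, which Tonelli's theorem permits.\<close>

lemma (in prob_space) distr_resample_swap:
  assumes i: "i < n"
  shows "distr (sample M n \<Otimes>\<^sub>M M) (sample M n \<Otimes>\<^sub>M M) (resample_swap i) = sample M n \<Otimes>\<^sub>M M"
proof -
  interpret S: prob_space "sample M n" by (rule prob_space_sample)
  interpret PS: pair_prob_space "sample M n" M ..
  interpret P: product_sigma_finite "\<lambda>_::nat. M"
    by (rule product_sigma_finite.intro) (rule sigma_finite_measure_axioms)
  have split: "(\<integral>\<^sup>+ w. h w \<partial>(sample M n \<Otimes>\<^sub>M M))
      = (\<integral>\<^sup>+ z. (\<integral>\<^sup>+ u. (\<integral>\<^sup>+ y. h (z(i := u), y) \<partial>M) \<partial>M) \<partial>Pi\<^sub>M ({..<n} - {i}) (\<lambda>_. M))"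
    if [measurable]: "h \<in> borel_measurable (sample M n \<Otimes>\<^sub>M M)" for h
  proof -
    have ins: "insert i ({..<n} - {i}) = {..<n}" using i by auto
    have "(\<integral>\<^sup>+ w. h w \<partial>(sample M n \<Otimes>\<^sub>M M)) = (\<integral>\<^sup>+ x. \<integral>\<^sup>+ y. h (x, y) \<partial>M \<partial>sample M n)"
      by (intro nn_integral_fst[symmetric]) auto
    also have "\<dots> = (\<integral>\<^sup>+ x. \<integral>\<^sup>+ y. h (x, y) \<partial>M \<partial>Pi\<^sub>M (insert i ({..<n} - {i})) (\<lambda>_. M))"
      unfolding ins sample_def ..
    also have "\<dots> = (\<integral>\<^sup>+ z. (\<integral>\<^sup>+ u. (\<integral>\<^sup>+ y. h (z(i := u), y) \<partial>M) \<partial>M) \<partial>Pi\<^sub>M ({..<n} - {i}) (\<lambda>_. M))"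
    proof (rule P.product_nn_integral_insert)
      show "(\<lambda>x. \<integral>\<^sup>+ y. h (x, y) \<partial>M) \<in> borel_measurable (Pi\<^sub>M (insert i ({..<n} - {i})) (\<lambda>_. M))"
        unfolding ins sample_def[symmetric] by measurable
    qed auto
    finally show ?thesis .
  qed
  show ?thesis
  proof (rule measure_eqI)
    fix A assume "A \<in> sets (distr (sample M n \<Otimes>\<^sub>M M) (sample M n \<Otimes>\<^sub>M M) (resample_swap i))"
    then have A [measurable]: "A \<in> sets (sample M n \<Otimes>\<^sub>M M)" by simp
    define I :: "(nat \<Rightarrow> 'a) \<times> 'a \<Rightarrow> ennreal" where "I = indicator A"
    have I [measurable]: "I \<in> borel_measurable (sample M n \<Otimes>\<^sub>M M)" by (simp add: I_def)
    \<comment> \<open>Membership of \<open>z\<close> in the product over the remaining indices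
      ensures that \<open>z(i := u)\<close> is a point of the sample space.\<close>
    have upd: "(\<lambda>(u, y). I (z(i := u), y)) \<in> borel_measurable (M \<Otimes>\<^sub>M M)"
      if z: "z \<in> space (Pi\<^sub>M ({..<n} - {i}) (\<lambda>_. M))" for z
    proof -
      have "(\<lambda>u. z(i := u)) \<in> M \<rightarrow>\<^sub>M Pi\<^sub>M (insert i ({..<n} - {i})) (\<lambda>_. M)"
        using z by (intro measurable_component_update) auto
      moreover have "insert i ({..<n} - {i}) = {..<n}" using i by auto
      ultimately have [measurable]: "(\<lambda>u. z(i := u)) \<in> M \<rightarrow>\<^sub>M sample M n"
        by (simp add: sample_def)
      show ?thesis by measurable
    qed
    have "emeasure (distr (sample M n \<Otimes>\<^sub>M M) (sample M n \<Otimes>\<^sub>M M) (resample_swap i)) A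
        = (\<integral>\<^sup>+ w. I w \<partial>distr (sample M n \<Otimes>\<^sub>M M) (sample M n \<Otimes>\<^sub>M M) (resample_swap i))"
      by (simp add: I_def)
    also have "\<dots> = (\<integral>\<^sup>+ w. I (resample_swap i w) \<partial>(sample M n \<Otimes>\<^sub>M M))"
      by (rule nn_integral_distr[OF measurable_resample_swap[OF i]]) simp
    also have "\<dots> = (\<integral>\<^sup>+ z. (\<integral>\<^sup>+ u. (\<integral>\<^sup>+ y. I (z(i := y), u) \<partial>M) \<partial>M) \<partial>Pi\<^sub>M ({..<n} - {i}) (\<lambda>_. M))"
      using split[OF measurable_compose[OF measurable_resample_swap[OF i] I]]
      by (simp add: resample_swap_def)
    also have "\<dots> = (\<integral>\<^sup>+ z. (\<integral>\<^sup>+ y. (\<integral>\<^sup>+ u. I (z(i := y), u) \<partial>M) \<partial>M) \<partial>Pi\<^sub>M ({..<n} - {i}) (\<lambda>_. M))"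
    proof (rule nn_integral_cong)
      fix z assume z: "z \<in> space (Pi\<^sub>M ({..<n} - {i}) (\<lambda>_. M))"
      interpret MM: pair_sigma_finite M M ..
      show "(\<integral>\<^sup>+ u. (\<integral>\<^sup>+ y. I (z(i := y), u) \<partial>M) \<partial>M) = (\<integral>\<^sup>+ y. (\<integral>\<^sup>+ u. I (z(i := y), u) \<partial>M) \<partial>M)"
        using MM.Fubini'[OF upd[OF z]] .
    qed
    also have "\<dots> = (\<integral>\<^sup>+ w. I w \<partial>(sample M n \<Otimes>\<^sub>M M))"
      by (rule split[OF I, symmetric])
    finally show "emeasure (distr (sample M n \<Otimes>\<^sub>M M) (sample M n \<Otimes>\<^sub>M M) (resample_swap i)) A
        = emeasure (sample M n \<Otimes>\<^sub>M M) A"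
      by (simp add: I_def)
  qed simp
qed

lemma (in prob_space) nn_integral_resample_swap:
  assumes i: "i < n" and h[measurable]: "h \<in> borel_measurable (sample M n \<Otimes>\<^sub>M M)"
  shows "(\<integral>\<^sup>+ w. h (resample_swap i w) \<partial>(sample M n \<Otimes>\<^sub>M M)) = (\<integral>\<^sup>+ w. h w \<partial>(sample M n \<Otimes>\<^sub>M M))"
  using nn_integral_distr[OF measurable_resample_swap[OF i], of h M, unfolded distr_resample_swap[OF i], OF h]
  by (rule sym)

text \<open>The modified sample is the first component of the measure-preserving exchange, so the
  property is pulled back along that map. Existence of an empirical minimizer, to which this is
  applied, is only known almost everywhere.\<close>

lemma (in prob_space) AE_resample:
  assumes i: "i < n" and P: "AE x in sample M n. P x"
  shows "AE x in sample M n. AE y in M. P (x(i := y))"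
proof -
  interpret S: prob_space "sample M n" by (rule prob_space_sample)
  interpret PS: pair_prob_space "sample M n" M ..
  have "AE w in sample M n \<Otimes>\<^sub>M M. P (fst w)"
  proof (rule AE_distrD[where M' = "sample M n"])
    have "distr (sample M n \<Otimes>\<^sub>M M) (sample M n) fst = sample M n"
      by (rule distr_pair_fst)
    then show "AE x in distr (sample M n \<Otimes>\<^sub>M M) (sample M n) fst. P x"
      using P by metis
  qed simp
  then have "AE w in distr (sample M n \<Otimes>\<^sub>M M) (sample M n \<Otimes>\<^sub>M M) (resample_swap i). P (fst w)"
    unfolding distr_resample_swap[OF i] .
  then have "AE w in sample M n \<Otimes>\<^sub>M M. P (fst (resample_swap i w))"
    by (rule AE_distrD[OF measurable_resample_swap[OF i]])
  then have "AE x in sample M n. AE y in M. P (fst (resample_swap i (x, y)))"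
    by (rule PS.AE_pair)
  then show ?thesis by (simp add: resample_swap_def)
qed

lemma (in prob_space) nn_integral_sample_component:
  assumes i: "i < n" and f[measurable]: "f \<in> borel_measurable M"
  shows "(\<integral>\<^sup>+ x. f (x i) \<partial>sample M n) = (\<integral>\<^sup>+ u. f u \<partial>M)"
proof -
  have "(\<integral>\<^sup>+ u. f u \<partial>M) = (\<integral>\<^sup>+ u. f u \<partial>distr (sample M n) M (\<lambda>x. x i))"
    unfolding sample_def using i by (subst distr_PiM_component) (auto intro: prob_space_axioms)
  also have "\<dots> = (\<integral>\<^sup>+ x. f (x i) \<partial>sample M n)"
    by (rule nn_integral_distr[OF measurable_sample_component[OF i]]) simp
  finally show ?thesis ..
qed

lemma (in prob_space) AE_sample_component:
  assumes "AE u in M. P u"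
  shows "AE x in sample M n. \<forall>i<n. P (x i)"
proof -
  have "AE x in sample M n. \<forall>i\<in>{..<n}. P (x i)"
    unfolding sample_def
    by (intro AE_finite_allI AE_PiM_component assms prob_space_axioms) auto
  then show ?thesis by (simp add: lessThan_iff Ball_def)
qed

text \<open>The truncation makes the antisymmetric integrand bounded, so that its integral vanishes even
  if \<open>W\<close> is not integrable.\<close>

lemma (in prob_space) integral_exchange_truncated:
  fixes W :: "(nat \<Rightarrow> 'a) \<Rightarrow> real"
  assumes i: "i < n" and A[measurable]: "A \<in> sets (sample M n)"
    and W[measurable]: "W \<in> borel_measurable (sample M n)"
    and bound: "\<And>x. x \<in> A \<Longrightarrow> \<bar>W x\<bar> \<le> k"
  shows "(\<integral>\<^sup>+ x. \<integral>\<^sup>+ y. ennreal (indicator A (x(i := y)) * (W (x(i := y)) - W x) + 2 * k) * indicator A x \<partial>M \<partial>sample M n)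
    = ennreal (2 * k) * emeasure (sample M n) A"
    (is "?L = _")
proof (cases "A = {}")
  case False
  then obtain x where "x \<in> A" by auto
  then have k: "0 \<le> k" using bound[of x] by linarith
  interpret S: prob_space "sample M n" by (rule prob_space_sample)
  interpret PS: pair_prob_space "sample M n" M ..
  let ?Q = "sample M n \<Otimes>\<^sub>M M"
  note [measurable] = measurable_sample_update[OF i]
  define u where "u w = (case w of (x, y) \<Rightarrow> x(i := y))" for w :: "(nat \<Rightarrow> 'a) \<times> 'a"
  have u [measurable]: "u \<in> ?Q \<rightarrow>\<^sub>M sample M n"
    unfolding u_def using measurable_sample_update[OF i, of M] by (simp add: split_beta')
  \<comment> \<open>With both indicators present, \<open>B\<close> is bounded by
    \<open>2 * k\<close> and antisymmetric under the exchange; the first one is supplied by the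
    outer indicator of the integrand.\<close>
  define B :: "_ \<Rightarrow> real" where "B w = indicator A (fst w) * indicator A (u w) * (W (u w) - W (fst w))" for w
  have B_meas [measurable]: "B \<in> borel_measurable ?Q" unfolding B_def by measurable
  have B_bound: "\<bar>B w\<bar> \<le> 2 * k" for w
    using bound[of "fst w"] bound[of "u w"] k by (auto simp: B_def indicator_def)
  have B_int: "integrable ?Q B"
    using B_bound by (intro PS.P.integrable_const_bound[where B = "2 * k"]) auto
  have B_nonneg: "0 \<le> B w + 2 * k * indicator A (fst w)" for w
    using B_bound[of w] by (auto simp: B_def indicator_def)
  have A_int: "integrable ?Q (\<lambda>w. indicator A (fst w) :: real)"
    by (intro PS.P.integrable_const_bound[where B = 1]) auto
  have swap: "B (resample_swap i w) = - B w" for w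
    by (cases w) (simp add: B_def u_def resample_swap_def algebra_simps)
  have "integral\<^sup>L ?Q B = integral\<^sup>L (distr ?Q ?Q (resample_swap i)) B"
    by (simp add: distr_resample_swap[OF i])
  also have "\<dots> = integral\<^sup>L ?Q (\<lambda>w. B (resample_swap i w))"
    by (rule integral_distr[OF measurable_resample_swap[OF i]]) simp
  finally have B0: "integral\<^sup>L ?Q B = 0"
    by (simp add: swap)
  \<comment> \<open>The shift by \<open>2 * k\<close> keeps the real integrand nonnegative on
    \<open>A\<close>, so the coercion to \<open>ennreal\<close> truncates nothing and the
    antisymmetric part integrates to 0.\<close>
  have "?L = (\<integral>\<^sup>+ w. ennreal (indicator A (u w) * (W (u w) - W (fst w)) + 2 * k) * indicator A (fst w) \<partial>?Q)"
    by (subst nn_integral_fst[symmetric]) (measurable, simp add: u_def)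
  also have "\<dots> = (\<integral>\<^sup>+ w. ennreal (B w + 2 * k * indicator A (fst w)) \<partial>?Q)"
    by (intro nn_integral_cong) (auto simp: B_def indicator_def)
  also have "\<dots> = ennreal (\<integral> w. B w + 2 * k * indicator A (fst w) \<partial>?Q)"
  proof (rule nn_integral_eq_integral)
    show "integrable ?Q (\<lambda>w. B w + 2 * k * indicator A (fst w))"
      using A_int by (intro Bochner_Integration.integrable_add B_int) simp
    show "AE w in ?Q. 0 \<le> B w + 2 * k * indicator A (fst w)"
      using B_nonneg by simp
  qed
  also have "(\<integral> w. B w + 2 * k * indicator A (fst w) \<partial>?Q) = 2 * k * (\<integral> w. indicator A (fst w) \<partial>?Q)"
    using A_int B_int by (simp add: B0)
  also have "(\<integral> w. indicator A (fst w) \<partial>?Q) = measure (sample M n) A"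
  proof -
    have "(\<integral> w. indicator A (fst w) \<partial>?Q) = (\<integral> x. (indicator A x :: real) \<partial>distr ?Q (sample M n) fst)"
      by (rule integral_distr[symmetric]) auto
    also have "distr ?Q (sample M n) fst = sample M n"
      by (rule distr_pair_fst)
    finally show ?thesis by simp
  qed
  finally have "?L = ennreal (2 * k * measure (sample M n) A)" .
  also have "\<dots> = ennreal (2 * k) * emeasure (sample M n) A"
    using k by (simp add: ennreal_mult S.emeasure_eq_measure)
  finally show ?thesis .
qed simp

section \<open>Stability of empirical minimizers\<close>

text \<open>On the right only the positive parts survive the coercion, and an integral is at most
  the integral of the positive part. This is the passage from signed increments to nonnegative
  integrals.\<close>

lemma ennreal_sum_integral_le:
  fixes f :: "'i \<Rightarrow> 'a \<Rightarrow> real"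
  assumes "finite I" "\<And>i. i \<in> I \<Longrightarrow> integrable M (f i)"
  shows "ennreal (\<Sum>i\<in>I. integral\<^sup>L M (f i)) \<le> (\<Sum>i\<in>I. \<integral>\<^sup>+ y. ennreal (f i y) \<partial>M)"
proof -
  have "integral\<^sup>L M (f i) \<le> enn2real (\<integral>\<^sup>+ y. ennreal (f i y) \<partial>M)" if "i \<in> I" for i
    using real_lebesgue_integral_def[OF assms(2)[OF that]] by simp
  then have "ennreal (\<Sum>i\<in>I. integral\<^sup>L M (f i)) \<le> ennreal (\<Sum>i\<in>I. enn2real (\<integral>\<^sup>+ y. ennreal (f i y) \<partial>M))"
    by (intro ennreal_leI sum_mono)
  also have "\<dots> = (\<Sum>i\<in>I. ennreal (enn2real (\<integral>\<^sup>+ y. ennreal (f i y) \<partial>M)))"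
    by (intro sum_ennreal[symmetric]) simp
  also have "\<dots> \<le> (\<Sum>i\<in>I. \<integral>\<^sup>+ y. ennreal (f i y) \<partial>M)"
    by (intro sum_mono ennreal_enn2real_if[THEN eq_refl, THEN order.trans]) auto
  finally show ?thesis .
qed

lemma minimizers_le: "\<phi> \<in> minimizers f \<Longrightarrow> f \<phi> \<le> f \<psi>"
  by (auto simp: minimizers_def is_arg_min_def not_less)

lemma min_value_eq: "\<phi> \<in> minimizers f \<Longrightarrow> min_value f = f \<phi>"
  unfolding min_value_def by (intro antisym INF_lower INF_greatest minimizers_le) auto

text \<open>The setting at one fixed sample size. Only a finite mean of \<open>a\<close> is recorded
  here, so that a vanishing psi_1 norm is covered; exponential moments enter in
  \<open>erm_sample_exp\<close>.\<close>

locale erm_sample = prob_space \<mu>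
  for \<mu> :: "'x::metric_space measure" +
  fixes l :: "'m::metric_space \<Rightarrow> 'x \<Rightarrow> real"
    and R :: "'m \<Rightarrow> ereal" and J0 :: ereal and \<alpha> \<beta> \<tau> :: real
    and a :: "'x \<Rightarrow> 'x \<Rightarrow> real" and \<Upsilon> :: "'m set" and n :: nat
  assumes support: "AE x in \<mu>. x \<in> measure_support \<mu>"
    and l_integrable: "\<And>\<phi>. integrable \<mu> (l \<phi>)"
    and R_not_MInf: "\<And>\<phi>. R \<phi> \<noteq> - \<infinity>"
    and meas_min_value: "(\<lambda>x. min_value (emp_risk l R n x)) \<in> borel_measurable (sample \<mu> n)"
    and meas_good: "good_set \<mu> l R \<tau> \<beta> J0 \<Upsilon> n \<in> sets (sample \<mu> n)"
    and meas_excess: "(\<lambda>x. excess_dist (minimizers (emp_risk l R n x)) (minimizers (risk \<mu> l R)))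
          \<in> borel_measurable (sample \<mu> n)"
    and meas_a: "(\<lambda>(x, y). a x y) \<in> borel_measurable (\<mu> \<Otimes>\<^sub>M \<mu>)"
    and J_proper: "proper (risk \<mu> l R)"
    and S_nonempty: "minimizers (risk \<mu> l R) \<noteq> {}"
    and emp_minimizers_exist: "AE x in sample \<mu> n. minimizers (emp_risk l R n x) \<noteq> {}"
    and tau_pos: "0 < \<tau>"
    and margin: "\<And>\<phi>. risk \<mu> l R \<phi> \<le> J0 \<Longrightarrow>
          ereal (\<tau> * infdist \<phi> (minimizers (risk \<mu> l R)) powr \<beta>) \<le> risk \<mu> l R \<phi> - min_value (risk \<mu> l R)"
    and alpha_pos: "0 < \<alpha>"
    and a_nonneg: "\<And>x y. 0 \<le> a x y"
    and a_finite: "(\<integral>\<^sup>+ w. ennreal (case w of (x, y) \<Rightarrow> a x y) \<partial>(\<mu> \<Otimes>\<^sub>M \<mu>)) < \<infinity>"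
    and S_subset: "minimizers (risk \<mu> l R) \<subseteq> \<Upsilon>"
    and increments: "AE x in \<mu>. AE y in \<mu>. \<forall>\<phi>\<in>\<Upsilon>. \<forall>\<psi>\<in>\<Upsilon>.
           l \<phi> x - l \<psi> x - l \<phi> y + l \<psi> y \<le> a x y * dist \<phi> \<psi> powr \<alpha>"
    and beta_gt_alpha: "\<alpha> < \<beta>"
    and n_ge_1: "1 \<le> n"
begin

abbreviation "S \<equiv> minimizers (risk \<mu> l R)"
abbreviation "Se x \<equiv> minimizers (emp_risk l R n x)"
abbreviation "A \<equiv> good_set \<mu> l R \<tau> \<beta> J0 \<Upsilon> n"
abbreviation "s \<equiv> \<alpha> / (\<beta> - \<alpha>)"

text \<open>Real-valued copy of \<open>emp_risk\<close>, so that differences can be formed freely.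
  The two agree only where \<open>R\<close> is finite, because \<open>real_of_ereal\<close> sends
  infinity to 0; all minimizers lie there.\<close>

definition emp :: "(nat \<Rightarrow> 'x) \<Rightarrow> 'm \<Rightarrow> real" where
  "emp x \<phi> = 1 / real n * (\<Sum>i<n. l \<phi> (x i)) + real_of_ereal (R \<phi>)"

text \<open>The random coefficient in the self-bounding inequality
  \<open>infdist_powr_self_bound\<close>.\<close>

definition abar :: "(nat \<Rightarrow> 'x) \<Rightarrow> real" where
  "abar x = 1 / real n * (\<Sum>i<n. \<integral>y. a (x i) y \<partial>\<mu>)"

definition incr :: "'x \<Rightarrow> 'x \<Rightarrow> bool" where
  "incr x y \<longleftrightarrow> (\<forall>\<phi>\<in>\<Upsilon>. \<forall>\<psi>\<in>\<Upsilon>. l \<phi> x - l \<psi> x - l \<phi> y + l \<psi> y \<le> a x y * dist \<phi> \<psi> powr \<alpha>)"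

text \<open>The pairs satisfying \<open>incr\<close> need not form a measurable set, so \<open>increments\<close> says nothing about
  almost every pair: it can only be used for almost every \<open>y\<close> with the sample fixed.\<close>

definition regular :: "(nat \<Rightarrow> 'x) \<Rightarrow> bool" where
  "regular x \<longleftrightarrow> x \<in> space (sample \<mu> n) \<and> Se x \<noteq> {} \<and>
     (\<forall>i<n. x i \<in> measure_support \<mu> \<and> (AE y in \<mu>. incr (x i) y) \<and> integrable \<mu> (a (x i)))"

lemma s_pos: "0 < s"
  using alpha_pos beta_gt_alpha by simp

lemma n_pos: "0 < real n"
  using n_ge_1 by simp

lemma meas_A [measurable]: "A \<in> sets (sample \<mu> n)"
  by (rule meas_good)

lemma meas_a' [measurable]: "case_prod a \<in> borel_measurable (\<mu> \<Otimes>\<^sub>M \<mu>)"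
  using meas_a by (simp add: case_prod_beta')

lemma proper_point: obtains \<psi> where "R \<psi> \<noteq> \<infinity>"
  using J_proper by (auto simp: proper_def risk_def)

lemma emp_risk_eq: "R \<phi> \<noteq> \<infinity> \<Longrightarrow> emp_risk l R n x \<phi> = ereal (emp x \<phi>)"
  using R_not_MInf[of \<phi>] by (cases "R \<phi>") (auto simp: emp_risk_def emp_def)

lemma risk_eq: "R \<phi> \<noteq> \<infinity> \<Longrightarrow> risk \<mu> l R \<phi> = ereal ((\<integral>y. l \<phi> y \<partial>\<mu>) + real_of_ereal (R \<phi>))"
  using R_not_MInf[of \<phi>] by (cases "R \<phi>") (auto simp: risk_def)

lemma Se_R_finite: "\<phi> \<in> Se x \<Longrightarrow> R \<phi> \<noteq> \<infinity>"
proof -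
  assume \<phi>: "\<phi> \<in> Se x"
  obtain \<psi> where \<psi>: "R \<psi> \<noteq> \<infinity>" by (rule proper_point)
  have "emp_risk l R n x \<phi> \<le> ereal (emp x \<psi>)"
    using minimizers_le[OF \<phi>, of \<psi>] \<psi> by (simp add: emp_risk_eq)
  then show ?thesis by (auto simp: emp_risk_def)
qed

lemma S_R_finite: "\<phi> \<in> S \<Longrightarrow> R \<phi> \<noteq> \<infinity>"
proof -
  assume \<phi>: "\<phi> \<in> S"
  obtain \<psi> where \<psi>: "R \<psi> \<noteq> \<infinity>" by (rule proper_point)
  have "risk \<mu> l R \<phi> \<le> ereal ((\<integral>y. l \<psi> y \<partial>\<mu>) + real_of_ereal (R \<psi>))"
    using minimizers_le[OF \<phi>, of \<psi>] \<psi> by (simp add: risk_eq)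
  then show ?thesis by (auto simp: risk_def)
qed

lemma emp_minimizer_le: "\<phi> \<in> Se x \<Longrightarrow> R \<psi> \<noteq> \<infinity> \<Longrightarrow> emp x \<phi> \<le> emp x \<psi>"
  using minimizers_le[of \<phi> "emp_risk l R n x" \<psi>] by (simp add: emp_risk_eq Se_R_finite)

lemma min_emp_eq: "\<phi> \<in> Se x \<Longrightarrow> real_of_ereal (min_value (emp_risk l R n x)) = emp x \<phi>"
  by (simp add: min_value_eq emp_risk_eq Se_R_finite)

lemma emp_update:
  assumes "i < n"
  shows "real n * (emp (x(i := y)) \<phi> - emp x \<phi>) = l \<phi> y - l \<phi> (x i)"
proof -
  have "(\<Sum>j<n. l \<phi> ((x(i := y)) j)) = l \<phi> y + (\<Sum>j\<in>{..<n} - {i}. l \<phi> (x j))"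
    using assms by (subst sum.remove[of _ i]) auto
  moreover have "(\<Sum>j<n. l \<phi> (x j)) = l \<phi> (x i) + (\<Sum>j\<in>{..<n} - {i}. l \<phi> (x j))"
    using assms by (subst sum.remove[of _ i]) auto
  ultimately show ?thesis
    using n_pos by (simp add: emp_def right_diff_distrib distrib_left)
qed

lemma A_subset: "x \<in> A \<Longrightarrow> Se x \<subseteq> \<Upsilon>"
  by (simp add: good_set_def)

lemma A_risk: "x \<in> A \<Longrightarrow> \<phi> \<in> Se x \<Longrightarrow> risk \<mu> l R \<phi> \<le> J0"
  by (auto simp: good_set_def SUP_le_iff)

section \<open>Margin condition and distance to the risk minimizers\<close>

text \<open>The margin condition bounds the left side by an excess risk. Adding the nonnegative
  quantity \<open>emp x \<psi> - emp x \<phi>\<close> cancels the terms with \<open>R\<close> and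
  leaves population means minus sample means.\<close>

lemma margin_increments:
  assumes x: "x \<in> A" and \<phi>: "\<phi> \<in> Se x" and \<psi>: "\<psi> \<in> S"
  shows "\<tau> * infdist \<phi> S powr \<beta>
    \<le> 1 / real n * (\<Sum>i<n. \<integral>y. l \<phi> y - l \<psi> y - l \<phi> (x i) + l \<psi> (x i) \<partial>\<mu>)"
proof -
  have fin: "R \<phi> \<noteq> \<infinity>" "R \<psi> \<noteq> \<infinity>"
    using Se_R_finite[OF \<phi>] S_R_finite[OF \<psi>] by auto
  have "\<tau> * infdist \<phi> S powr \<beta>
      \<le> (\<integral>y. l \<phi> y \<partial>\<mu>) + real_of_ereal (R \<phi>) - ((\<integral>y. l \<psi> y \<partial>\<mu>) + real_of_ereal (R \<psi>))"
    using margin[OF A_risk[OF x \<phi>]] fin by (simp add: min_value_eq[OF \<psi>] risk_eq)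
  also have "\<dots> \<le> (\<integral>y. l \<phi> y \<partial>\<mu>) - (\<integral>y. l \<psi> y \<partial>\<mu>)
      - 1 / real n * (\<Sum>i<n. l \<phi> (x i)) + 1 / real n * (\<Sum>i<n. l \<psi> (x i))"
    using emp_minimizer_le[OF \<phi> fin(2)] by (simp add: emp_def)
  also have "\<dots> = 1 / real n * (\<Sum>i<n. (\<integral>y. l \<phi> y \<partial>\<mu>) - (\<integral>y. l \<psi> y \<partial>\<mu>) - l \<phi> (x i) + l \<psi> (x i))"
    using n_pos by (simp add: sum.distrib sum_subtractf field_simps)
  also have "\<dots> = 1 / real n * (\<Sum>i<n. \<integral>y. l \<phi> y - l \<psi> y - l \<phi> (x i) + l \<psi> (x i) \<partial>\<mu>)"
    using l_integrable by (simp add: prob_space)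
  finally show ?thesis .
qed

text \<open>The condition is applied to the pair in reversed order, which flips the sign of the
  increment.\<close>

lemma incrD:
  assumes "incr x y" "\<phi> \<in> \<Upsilon>" "\<psi> \<in> \<Upsilon>"
  shows "l \<phi> y - l \<psi> y - l \<phi> x + l \<psi> x \<le> a x y * dist \<phi> \<psi> powr \<alpha>"
proof -
  have "l \<psi> x - l \<phi> x - l \<psi> y + l \<phi> y \<le> a x y * dist \<psi> \<phi> powr \<alpha>"
    using assms unfolding incr_def by blast
  then show ?thesis by (simp add: dist_commute)
qed

lemma abar_nonneg: "0 \<le> abar x"
  unfolding abar_def by (intro mult_nonneg_nonneg sum_nonneg integral_nonneg_AE AE_I2 a_nonneg) auto

text \<open>A crude bound that involves no stability: every increment is estimated by
  \<open>a\<close> directly. The left side does not depend on \<open>\<psi>\<close>, so the distance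
  to \<open>\<psi>\<close> may be replaced by the distance to \<open>S\<close>. It controls the
  escaping samples and settles the case where \<open>a\<close> vanishes almost everywhere.\<close>

lemma infdist_powr_self_bound:
  assumes x: "x \<in> A" "regular x" and \<phi>: "\<phi> \<in> Se x"
  shows "\<tau> * infdist \<phi> S powr \<beta> \<le> abar x * infdist \<phi> S powr \<alpha>"
proof (rule le_mult_infdist_powr[OF S_nonempty alpha_pos abar_nonneg])
  fix \<psi> assume \<psi>: "\<psi> \<in> S"
  have mem: "\<phi> \<in> \<Upsilon>" "\<psi> \<in> \<Upsilon>"
    using A_subset[OF x(1)] \<phi> S_subset \<psi> by auto
  have "\<tau> * infdist \<phi> S powr \<beta>
      \<le> 1 / real n * (\<Sum>i<n. \<integral>y. l \<phi> y - l \<psi> y - l \<phi> (x i) + l \<psi> (x i) \<partial>\<mu>)"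
    by (rule margin_increments[OF x(1) \<phi> \<psi>])
  also have "\<dots> \<le> 1 / real n * (\<Sum>i<n. \<integral>y. a (x i) y * dist \<phi> \<psi> powr \<alpha> \<partial>\<mu>)"
  proof (intro mult_left_mono sum_mono integral_mono_AE)
    fix i assume "i \<in> {..<n}"
    then have i: "AE y in \<mu>. incr (x i) y" "integrable \<mu> (a (x i))"
      using x(2) by (auto simp: regular_def)
    show "AE y in \<mu>. l \<phi> y - l \<psi> y - l \<phi> (x i) + l \<psi> (x i) \<le> a (x i) y * dist \<phi> \<psi> powr \<alpha>"
      using i(1) by eventually_elim (use incrD mem in auto)
    show "integrable \<mu> (\<lambda>y. a (x i) y * dist \<phi> \<psi> powr \<alpha>)"
      using i(2) by simp
  qed (use l_integrable in auto)
  also have "\<dots> = abar x * dist \<phi> \<psi> powr \<alpha>"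
    by (simp add: abar_def sum_distrib_right sum_divide_distrib)
  finally show "\<tau> * infdist \<phi> S powr \<beta> \<le> abar x * dist \<phi> \<psi> powr \<alpha>" .
qed

lemma infdist_powr_le:
  assumes "x \<in> A" "regular x" "\<phi> \<in> Se x"
  shows "infdist \<phi> S powr \<alpha> \<le> (abar x / \<tau>) powr s"
  using powr_bound_of_powr_le[OF infdist_nonneg tau_pos abar_nonneg alpha_pos beta_gt_alpha infdist_powr_self_bound[OF assms]] .

text \<open>The original sample \<open>x\<close> itself competes in the infimum defining
  \<open>tau_hat\<close> for the modified sample: regularity puts its observations in the support,
  and goodness puts the risk of \<open>\<phi>\<close> below \<open>J0\<close>.\<close>

lemma tau_hat_bound:
  assumes x: "x \<in> A" "regular x" and \<phi>: "\<phi> \<in> Se x" and x': "x' \<in> A" "Se x' \<noteq> {}"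
  shows "\<tau> / 2 * infdist \<phi> (Se x') powr \<beta> \<le> emp x' \<phi> - real_of_ereal (min_value (emp_risk l R n x'))"
proof (cases "infdist \<phi> (Se x') = 0")
  \<comment> \<open>\<open>tau_hat\<close> disregards such points; here the left side is 0 and the
    right side is nonnegative by minimality.\<close>
  case True
  obtain \<psi> where \<psi>: "\<psi> \<in> Se x'" using x'(2) by auto
  show ?thesis
    using emp_minimizer_le[OF \<psi> Se_R_finite[OF \<phi>]] min_emp_eq[OF \<psi>] True alpha_pos beta_gt_alpha by simp
next
  case False
  then have pos: "0 < infdist \<phi> (Se x') powr \<beta>" by simp
  obtain \<psi> where \<psi>: "\<psi> \<in> Se x'" using x'(2) by auto
  have "x \<in> {..<n} \<rightarrow>\<^sub>E measure_support \<mu>"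
    using x(2) by (auto simp: regular_def space_sample PiE_iff)
  then have "tau_hat \<mu> l R \<beta> J0 n x'
      \<le> (emp_risk l R n x' \<phi> - min_value (emp_risk l R n x')) / ereal (infdist \<phi> (Se x') powr \<beta>)"
    unfolding tau_hat_def using A_risk[OF x(1) \<phi>] \<phi> False by (intro INF_lower2[of x] INF_lower) auto
  moreover have "ereal (\<tau> / 2) \<le> tau_hat \<mu> l R \<beta> J0 n x'"
    using x'(1) by (simp add: good_set_def)
  ultimately have "ereal (\<tau> / 2) \<le> ereal (emp x' \<phi> - emp x' \<psi>) / ereal (infdist \<phi> (Se x') powr \<beta>)"
    using \<phi> \<psi> by (simp add: min_value_eq[OF \<psi>] emp_risk_eq Se_R_finite)
  then have "\<tau> / 2 \<le> (emp x' \<phi> - emp x' \<psi>) / infdist \<phi> (Se x') powr \<beta>"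
    using pos by simp
  then show ?thesis
    using pos by (simp add: min_emp_eq[OF \<psi>] pos_le_divide_eq)
qed

text \<open>The value of \<open>a u y * d powr \<alpha>\<close> at the largest \<open>d\<close>
  compatible with \<open>real n * \<tau> / 2 * d powr \<beta> \<le> a u y * d powr
  \<alpha>\<close>.\<close>

definition stab :: "'x \<Rightarrow> 'x \<Rightarrow> real" where
  "stab u y = a u y * (2 * a u y / (real n * \<tau>)) powr s"

lemma stab_nonneg: "0 \<le> stab u y"
  by (simp add: stab_def a_nonneg)

text \<open>The excess empirical risk of \<open>\<phi>\<close> on the modified sample is at most \<open>a(x\<^sub>i, y) \<vartheta>(\<phi>, Se x')\<^sup>\<alpha> / n\<close> because \<open>\<phi>\<close> minimizes on the original one,
  and at least \<open>\<tau> \<vartheta>(\<phi>, Se x')\<^sup>\<beta> / 2\<close> by the lower bound on \<open>tau_hat\<close>.\<close>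

lemma stability:
  assumes x: "x \<in> A" "regular x" and \<phi>: "\<phi> \<in> Se x" and i: "i < n"
    and x': "x(i := y) \<in> A" "Se (x(i := y)) \<noteq> {}" and y: "incr (x i) y"
  shows "l \<phi> y - l \<phi> (x i) \<le> real n * (real_of_ereal (min_value (emp_risk l R n (x(i := y))))
     - real_of_ereal (min_value (emp_risk l R n x))) + stab (x i) y"
proof -
  let ?x' = "x(i := y)" and ?d = "infdist \<phi> (Se (x(i := y)))"
  define v where "v = real n * (emp ?x' \<phi> - real_of_ereal (min_value (emp_risk l R n ?x')))"
  have upper: "v \<le> a (x i) y * ?d powr \<alpha>"
  proof (rule le_mult_infdist_powr[OF x'(2) alpha_pos a_nonneg])
    fix \<psi> assume \<psi>: "\<psi> \<in> Se ?x'"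
    \<comment> \<open>Detour through the original sample: there \<open>\<phi>\<close> is a
      minimizer, so the last term is at most 0, while the first two are changes caused by a single
      observation.\<close>
    have "v = real n * (emp ?x' \<phi> - emp x \<phi>) - real n * (emp ?x' \<psi> - emp x \<psi>) + real n * (emp x \<phi> - emp x \<psi>)"
      by (simp add: v_def min_emp_eq[OF \<psi>] algebra_simps)
    also have "\<dots> \<le> (l \<phi> y - l \<phi> (x i)) - (l \<psi> y - l \<psi> (x i)) + real n * 0"
      unfolding emp_update[OF i] using emp_minimizer_le[OF \<phi> Se_R_finite[OF \<psi>]] n_pos
      by (intro add_left_mono mult_left_mono) auto
    also have "\<dots> \<le> a (x i) y * dist \<phi> \<psi> powr \<alpha>"
    proof -
      have "\<phi> \<in> \<Upsilon>" "\<psi> \<in> \<Upsilon>"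
        using A_subset[OF x(1)] A_subset[OF x'(1)] \<phi> \<psi> by auto
      from incrD[OF y this] show ?thesis by simp
    qed
    finally show "v \<le> a (x i) y * dist \<phi> \<psi> powr \<alpha>" .
  qed
  have "real n * (\<tau> / 2 * ?d powr \<beta>) \<le> v"
    unfolding v_def using tau_hat_bound[OF x \<phi> x'] n_pos by (intro mult_left_mono) auto
  with upper have "(real n * \<tau> / 2) * ?d powr \<beta> \<le> a (x i) y * ?d powr \<alpha>"
    by simp
  then have "?d powr \<alpha> \<le> (a (x i) y / (real n * \<tau> / 2)) powr s"
    using n_pos tau_pos alpha_pos beta_gt_alpha a_nonneg
    by (intro powr_bound_of_powr_le) (auto simp: infdist_nonneg)
  also have "a (x i) y / (real n * \<tau> / 2) = 2 * a (x i) y / (real n * \<tau>)"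
    by simp
  finally have "a (x i) y * ?d powr \<alpha> \<le> stab (x i) y"
    unfolding stab_def by (intro mult_left_mono a_nonneg)
  with upper have "v \<le> stab (x i) y" by linarith
  \<comment> \<open>The same quantity, now using that \<open>emp x \<phi>\<close> is the minimal
    empirical risk on \<open>x\<close>.\<close>
  moreover have "v = (l \<phi> y - l \<phi> (x i)) - real n * (real_of_ereal (min_value (emp_risk l R n ?x'))
     - real_of_ereal (min_value (emp_risk l R n x)))"
    using emp_update[OF i, of x y \<phi>, symmetric] by (simp add: v_def min_emp_eq[OF \<phi>] algebra_simps)
  ultimately show ?thesis by linarith
qed

text \<open>By Tonelli's theorem the finite mean of \<open>a\<close> makes almost every section
  integrable; each of the finitely many observations has law \<open>\<mu>\<close> and inherits the
  almost sure properties.\<close>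

lemma AE_regular: "AE x in sample \<mu> n. regular x"
proof -
  interpret PP: pair_prob_space \<mu> \<mu> ..
  have "AE u in \<mu>. integrable \<mu> (a u)"
  proof -
    have "(\<integral>\<^sup>+ u. (\<integral>\<^sup>+ y. ennreal (a u y) \<partial>\<mu>) \<partial>\<mu>) = (\<integral>\<^sup>+ w. ennreal (case w of (x, y) \<Rightarrow> a x y) \<partial>(\<mu> \<Otimes>\<^sub>M \<mu>))"
      by (subst nn_integral_fst[symmetric]) auto
    then have "AE u in \<mu>. (\<integral>\<^sup>+ y. ennreal (a u y) \<partial>\<mu>) \<noteq> \<infinity>"
      using a_finite by (intro nn_integral_PInf_AE) auto
    moreover have "AE u in \<mu>. u \<in> space \<mu>" by simp
    ultimately show ?thesis
    proof eventually_elim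
      case (elim u)
      then have [measurable]: "a u \<in> borel_measurable \<mu>"
        using measurable_Pair2[OF meas_a', of u] by simp
      show ?case
        using elim a_nonneg by (intro integrableI_nonneg) (auto simp: less_top)
    qed
  qed
  with support increments
  have "AE u in \<mu>. u \<in> measure_support \<mu> \<and> (AE y in \<mu>. incr u y) \<and> integrable \<mu> (a u)"
    unfolding incr_def by eventually_elim auto
  from AE_sample_component[OF this, of n] emp_minimizers_exist AE_space[of "sample \<mu> n"]
  show ?thesis
    by eventually_elim (auto simp: regular_def)
qed

end

section \<open>Averaging over the sample\<close>

lemma measurable_ennreal_powr [measurable]:
  assumes [measurable]: "f \<in> borel_measurable M"
  shows "(\<lambda>x. ennreal_powr (f x) p) \<in> borel_measurable M"
  unfolding ennreal_powr_def by measurable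

lemma nn_integral_cmult_sum:
  assumes "\<And>i. i \<in> I \<Longrightarrow> g i \<in> borel_measurable M"
  shows "(\<integral>\<^sup>+ x. c * (\<Sum>i\<in>I. g i x) \<partial>M) = c * (\<Sum>i\<in>I. \<integral>\<^sup>+ x. g i x \<partial>M)"
proof -
  have "(\<lambda>x. \<Sum>i\<in>I. g i x) \<in> borel_measurable M"
    using assms by (rule borel_measurable_sum)
  then have "(\<integral>\<^sup>+ x. c * (\<Sum>i\<in>I. g i x) \<partial>M) = c * (\<integral>\<^sup>+ x. (\<Sum>i\<in>I. g i x) \<partial>M)"
    by (rule nn_integral_cmult)
  also have "(\<integral>\<^sup>+ x. (\<Sum>i\<in>I. g i x) \<partial>M) = (\<Sum>i\<in>I. \<integral>\<^sup>+ x. g i x \<partial>M)"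
    using assms by (rule nn_integral_sum)
  finally show ?thesis .
qed

context erm_sample begin

definition escape :: "(nat \<Rightarrow> 'x) \<Rightarrow> nat \<Rightarrow> 'x \<Rightarrow> ennreal" where
  "escape x i y = ennreal (a (x i) y) * indicator (space (sample \<mu> n) - A) (x(i := y))"

text \<open>One bound for both cases: the stability term if the modified sample stays good, and
  otherwise \<open>a\<close> times the bound on the distance to a risk minimizer. The latter is
  multiplied out because its two parts have different moments; it is \<open>ennreal\<close>-valued
  because the diameter may be infinite.\<close>

definition penalty :: "(nat \<Rightarrow> 'x) \<Rightarrow> nat \<Rightarrow> 'x \<Rightarrow> ennreal" where
  "penalty x i y = ennreal (stab (x i) y) + ennreal (2 powr max 0 (\<alpha> - 1)) *
     (escape x i y * ennreal ((abar x / \<tau>) powr s) + escape x i y * ennreal_powr (ediameter S) \<alpha>)"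

definition W :: "'m \<Rightarrow> (nat \<Rightarrow> 'x) \<Rightarrow> real" where
  "W \<psi> x = real n * (real_of_ereal (min_value (emp_risk l R n x)) - emp x \<psi>)"

text \<open>An exhaustion of the good set on which \<open>W\<close> is bounded, as
  \<open>integral_exchange_truncated\<close> requires.\<close>

definition Atrunc :: "'m \<Rightarrow> nat \<Rightarrow> (nat \<Rightarrow> 'x) set" where
  "Atrunc \<psi> k = {x \<in> A. \<bar>W \<psi> x\<bar> \<le> real k}"

section \<open>Measurability of the terms\<close>

lemma measurable_emp [measurable]: "(\<lambda>x. emp x \<phi>) \<in> borel_measurable (sample \<mu> n)"
proof -
  have "(\<lambda>x. l \<phi> (x i)) \<in> borel_measurable (sample \<mu> n)" if "i < n" for i
    using measurable_compose[OF measurable_sample_component[OF that] borel_measurable_integrable[OF l_integrable]] .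
  then show ?thesis unfolding emp_def by (intro borel_measurable_add borel_measurable_times borel_measurable_sum) auto
qed

lemma measurable_W [measurable]: "W \<psi> \<in> borel_measurable (sample \<mu> n)"
proof -
  note [measurable] = meas_min_value
  show ?thesis unfolding W_def by measurable
qed

lemma measurable_Atrunc [measurable]: "Atrunc \<psi> k \<in> sets (sample \<mu> n)"
proof -
  have "Atrunc \<psi> k = A \<inter> {x \<in> space (sample \<mu> n). \<bar>W \<psi> x\<bar> \<le> real k}"
    using sets.sets_into_space[OF meas_A] by (auto simp: Atrunc_def)
  then show ?thesis by simp
qed

lemma measurable_abar [measurable]: "abar \<in> borel_measurable (sample \<mu> n)"
proof -
  have "(\<lambda>u. \<integral>y. a u y \<partial>\<mu>) \<in> borel_measurable \<mu>"
    by (intro borel_measurable_lebesgue_integral) simp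
  then have "(\<lambda>x. \<integral>y. a (x i) y \<partial>\<mu>) \<in> borel_measurable (sample \<mu> n)" if "i < n" for i
    using measurable_compose[OF measurable_sample_component[OF that]] by blast
  then show ?thesis unfolding abar_def by (intro borel_measurable_times borel_measurable_sum) auto
qed

lemma measurable_a_component [measurable]:
  assumes "i < n"
  shows "(\<lambda>w. a (fst w i) (snd w)) \<in> borel_measurable (sample \<mu> n \<Otimes>\<^sub>M \<mu>)"
proof -
  have "(\<lambda>w. (fst w i, snd w)) \<in> sample \<mu> n \<Otimes>\<^sub>M \<mu> \<rightarrow>\<^sub>M \<mu> \<Otimes>\<^sub>M \<mu>"
    by (rule measurable_Pair[OF measurable_compose[OF measurable_fst measurable_sample_component[OF assms]] measurable_snd])
  from measurable_compose[OF this meas_a'] show ?thesis by simp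
qed

lemma measurable_update [measurable]:
  "i < n \<Longrightarrow> (\<lambda>w. (fst w)(i := snd w)) \<in> sample \<mu> n \<Otimes>\<^sub>M \<mu> \<rightarrow>\<^sub>M sample \<mu> n"
  using measurable_sample_update[of i n \<mu>] by (simp add: split_beta')

lemma measurable_stab [measurable]:
  "i < n \<Longrightarrow> (\<lambda>w. stab (fst w i) (snd w)) \<in> borel_measurable (sample \<mu> n \<Otimes>\<^sub>M \<mu>)"
  unfolding stab_def by measurable

lemma measurable_escape [measurable]:
  "i < n \<Longrightarrow> (\<lambda>w. escape (fst w) i (snd w)) \<in> borel_measurable (sample \<mu> n \<Otimes>\<^sub>M \<mu>)"
  unfolding escape_def by measurable

lemma measurable_penalty [measurable]:
  "i < n \<Longrightarrow> (\<lambda>w. penalty (fst w) i (snd w)) \<in> borel_measurable (sample \<mu> n \<Otimes>\<^sub>M \<mu>)"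
  unfolding penalty_def by measurable

text \<open>The summand with \<open>W\<close> may be dropped when the modified sample leaves \<open>Atrunc\<close> but stays in
  \<open>A\<close>: since \<open>W \<le> 0\<close>, its value has then decreased.\<close>

lemma increment_le_penalty:
  assumes \<psi>: "\<psi> \<in> S" and x: "x \<in> Atrunc \<psi> k" "regular x" and \<phi>: "\<phi> \<in> Se x" and i: "i < n"
    and y: "Se (x(i := y)) \<noteq> {}" "incr (x i) y" "y \<in> space \<mu>"
  shows "ennreal (l \<phi> y - l \<psi> y - l \<phi> (x i) + l \<psi> (x i) + 2 * real k)
    \<le> ennreal (indicator (Atrunc \<psi> k) (x(i := y)) * (W \<psi> (x(i := y)) - W \<psi> x) + 2 * real k) + penalty x i y"
    (is "ennreal (?D + _) \<le> ennreal (?B + _) + _")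
proof -
  let ?x' = "x(i := y)"
  have xA: "x \<in> A" and xk: "\<bar>W \<psi> x\<bar> \<le> real k" using x(1) by (auto simp: Atrunc_def)
  \<comment> \<open>Both values of \<open>W\<close> are at most \<open>k\<close> in modulus when the
    indicator is 1, so the shift makes addition in \<open>ennreal\<close> agree with addition of
    reals.\<close>
  have B: "0 \<le> ?B + 2 * real k"
    using xk by (auto simp: Atrunc_def indicator_def)
  have space: "?x' \<in> space (sample \<mu> n)"
    using x(2) y(3) i by (auto simp: regular_def space_sample PiE_iff extensional_def)
  show ?thesis
  proof (cases "?x' \<in> A")
    case True
    have "?D = (l \<phi> y - l \<phi> (x i)) - real n * (emp ?x' \<psi> - emp x \<psi>)"
      unfolding emp_update[OF i] by simp
    also have "\<dots> \<le> W \<psi> ?x' - W \<psi> x + stab (x i) y"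
      using stability[OF xA x(2) \<phi> i True y(1,2)] by (simp add: W_def algebra_simps)
    also have "\<dots> \<le> ?B + stab (x i) y"
    proof (cases "?x' \<in> Atrunc \<psi> k")
      case False
      obtain \<xi> where \<xi>: "\<xi> \<in> Se ?x'" using y(1) by auto
      have "W \<psi> ?x' \<le> 0"
        using emp_minimizer_le[OF \<xi> S_R_finite[OF \<psi>]] n_pos
        by (simp add: W_def min_emp_eq[OF \<xi>] mult_nonneg_nonpos)
      moreover have "\<not> \<bar>W \<psi> ?x'\<bar> \<le> real k"
        using False True by (simp add: Atrunc_def)
      \<comment> \<open>These facts force \<open>W\<close> on the modified sample below
        \<open>- real k\<close>, hence below its value on \<open>x\<close>: the true difference is
        negative, whereas the truncated one is 0.\<close>
      ultimately show ?thesis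
        using False xk by simp
    qed simp
    finally have "ennreal (?D + 2 * real k) \<le> ennreal ((?B + 2 * real k) + stab (x i) y)"
      by (intro ennreal_leI) simp
    also have "\<dots> = ennreal (?B + 2 * real k) + ennreal (stab (x i) y)"
      by (intro ennreal_plus B stab_nonneg)
    also have "\<dots> \<le> ennreal (?B + 2 * real k) + penalty x i y"
      by (intro add_left_mono) (simp add: penalty_def)
    finally show ?thesis .
  next
    case False
    then have B0: "?B = 0" by (simp add: Atrunc_def)
    have mem: "\<phi> \<in> \<Upsilon>" "\<psi> \<in> \<Upsilon>"
      using A_subset[OF xA] \<phi> S_subset \<psi> by auto
    have esc: "escape x i y = ennreal (a (x i) y)"
      using False space by (simp add: escape_def)
    have "ennreal (?D + 2 * real k) \<le> ennreal (a (x i) y * dist \<phi> \<psi> powr \<alpha> + 2 * real k)"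
      using incrD[OF y(2) mem] by (intro ennreal_leI) simp
    also have "\<dots> = ennreal (a (x i) y) * ennreal (dist \<phi> \<psi> powr \<alpha>) + ennreal (2 * real k)"
      by (simp add: ennreal_mult a_nonneg)
    also have "\<dots> \<le> ennreal (a (x i) y) * (ennreal (2 powr max 0 (\<alpha> - 1)) *
        (ennreal (infdist \<phi> S powr \<alpha>) + ennreal_powr (ediameter S) \<alpha>)) + ennreal (2 * real k)"
      by (intro add_right_mono mult_left_mono ennreal_dist_powr_le \<psi> alpha_pos) auto
    also have "\<dots> \<le> ennreal (a (x i) y) * (ennreal (2 powr max 0 (\<alpha> - 1)) *
        (ennreal ((abar x / \<tau>) powr s) + ennreal_powr (ediameter S) \<alpha>)) + ennreal (2 * real k)"
      by (intro add_right_mono mult_left_mono ennreal_leI infdist_powr_le xA x \<phi>) auto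
    also have "\<dots> = ennreal (2 powr max 0 (\<alpha> - 1)) *
        (escape x i y * ennreal ((abar x / \<tau>) powr s) + escape x i y * ennreal_powr (ediameter S) \<alpha>) + ennreal (2 * real k)"
      by (simp add: esc distrib_left mult_ac)
    also have "\<dots> \<le> penalty x i y + ennreal (2 * real k)"
      by (intro add_right_mono) (simp add: penalty_def)
    finally show ?thesis by (simp add: B0 add.commute)
  qed
qed

text \<open>The increment bound is integrated over \<open>y\<close> and averaged over
  \<open>i\<close>. The result does not mention the empirical minimizer, so the supremum over all of
  them can be taken at the end. The constant \<open>2 * real k\<close> is carried on both sides
  because the exchange term alone may be negative.\<close>

lemma excess_le_penalty:
  assumes \<psi>: "\<psi> \<in> S" and x: "x \<in> Atrunc \<psi> k" "regular x"
    and upd: "\<And>i. i < n \<Longrightarrow> AE y in \<mu>. Se (x(i := y)) \<noteq> {}"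
  shows "ennreal \<tau> * ennreal_powr (excess_dist (Se x) S) \<beta> + ennreal (2 * real k)
    \<le> ennreal (1 / real n) * (\<Sum>i<n. \<integral>\<^sup>+ y. (ennreal (indicator (Atrunc \<psi> k) (x(i := y))
          * (W \<psi> (x(i := y)) - W \<psi> x) + 2 * real k) + penalty x i y) \<partial>\<mu>)"
    (is "_ \<le> ?C")
proof -
  have main: "ennreal (\<tau> * infdist \<phi> S powr \<beta> + 2 * real k) \<le> ?C" if \<phi>: "\<phi> \<in> Se x" for \<phi>
  proof -
    let ?f = "\<lambda>i y. l \<phi> y - l \<psi> y - l \<phi> (x i) + l \<psi> (x i) + 2 * real k"
    have int: "integrable \<mu> (?f i)" for i
      using l_integrable by simp
    have xA: "x \<in> A" using x(1) by (simp add: Atrunc_def)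
    have "\<tau> * infdist \<phi> S powr \<beta> + 2 * real k
        \<le> 1 / real n * (\<Sum>i<n. \<integral>y. l \<phi> y - l \<psi> y - l \<phi> (x i) + l \<psi> (x i) \<partial>\<mu>) + 2 * real k"
      using margin_increments[OF xA \<phi> \<psi>] by simp
    also have "\<dots> = 1 / real n * (\<Sum>i<n. (\<integral>y. l \<phi> y - l \<psi> y - l \<phi> (x i) + l \<psi> (x i) \<partial>\<mu>) + 2 * real k)"
      using n_pos by (simp add: sum.distrib field_simps)
    also have "\<dots> = 1 / real n * (\<Sum>i<n. \<integral>y. ?f i y \<partial>\<mu>)"
      using l_integrable by (simp add: prob_space)
    finally have "ennreal (\<tau> * infdist \<phi> S powr \<beta> + 2 * real k) \<le> ennreal (1 / real n * (\<Sum>i<n. \<integral>y. ?f i y \<partial>\<mu>))"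
      by (rule ennreal_leI)
    also have "\<dots> = ennreal (1 / real n) * ennreal (\<Sum>i<n. \<integral>y. ?f i y \<partial>\<mu>)"
      by (rule ennreal_mult') simp
    also have "\<dots> \<le> ennreal (1 / real n) * (\<Sum>i<n. \<integral>\<^sup>+ y. ennreal (?f i y) \<partial>\<mu>)"
      by (intro mult_left_mono ennreal_sum_integral_le int) auto
    also have "\<dots> \<le> ?C"
    proof (intro mult_left_mono sum_mono nn_integral_mono_AE)
      fix i assume "i \<in> {..<n}"
      then have i: "i < n" by simp
      have "AE y in \<mu>. incr (x i) y" using x(2) i by (simp add: regular_def)
      with upd[OF i] AE_space[of \<mu>]
      show "AE y in \<mu>. ennreal (?f i y) \<le> ennreal (indicator (Atrunc \<psi> k) (x(i := y))
          * (W \<psi> (x(i := y)) - W \<psi> x) + 2 * real k) + penalty x i y"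
        by eventually_elim (rule increment_le_penalty[OF \<psi> x \<phi> i])
    qed simp
    finally show ?thesis .
  qed
  obtain \<phi> where \<phi>: "\<phi> \<in> Se x" using x(2) by (auto simp: regular_def)
  show ?thesis
  proof (cases ?C)
    case top
    then show ?thesis by simp
  next
    case (real c)
    have main': "\<tau> * infdist \<phi> S powr \<beta> + 2 * real k \<le> c" if "\<phi> \<in> Se x" for \<phi>
    proof -
      have "ennreal (\<tau> * infdist \<phi> S powr \<beta> + 2 * real k) \<le> ennreal c"
        using main[OF that] unfolding real(2) .
      then show ?thesis using real(1) by simp
    qed
    \<comment> \<open>Guarantees that \<open>2 * real k\<close> can be subtracted from
      \<open>c\<close> and added back without truncation.\<close>
    have "0 \<le> \<tau> * infdist \<phi> S powr \<beta>" using tau_pos by simp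
    then have c: "2 * real k \<le> c" using main'[OF \<phi>] by linarith
    have "ennreal_powr (excess_dist (Se x) S) \<beta> \<le> ennreal ((c - 2 * real k) / \<tau>)"
    proof (rule ennreal_powr_excess_dist_le)
      show "0 < \<beta>" using alpha_pos beta_gt_alpha by simp
      fix \<xi> assume "\<xi> \<in> Se x"
      then show "ennreal (infdist \<xi> S powr \<beta>) \<le> ennreal ((c - 2 * real k) / \<tau>)"
        using main'[of \<xi>] tau_pos by (intro ennreal_leI) (simp add: field_simps)
    qed
    then have "ennreal \<tau> * ennreal_powr (excess_dist (Se x) S) \<beta> + ennreal (2 * real k)
        \<le> ennreal \<tau> * ennreal ((c - 2 * real k) / \<tau>) + ennreal (2 * real k)"
      by (intro add_right_mono mult_left_mono) auto
    also have "\<dots> = ennreal (c - 2 * real k) + ennreal (2 * real k)"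
      using tau_pos c by (simp add: ennreal_mult[symmetric])
    also have "\<dots> = ennreal c"
      using c by (subst ennreal_plus[symmetric]) auto
    finally show ?thesis unfolding real(2) .
  qed
qed

lemma AE_update_minimizers:
  "AE x in sample \<mu> n. \<forall>i\<in>{..<n}. AE y in \<mu>. Se (x(i := y)) \<noteq> {}"
  by (intro AE_finite_allI AE_resample emp_minimizers_exist) auto

text \<open>Integration over the sample removes the exchange term: each index contributes exactly
  \<open>2 * real k\<close> times the probability of \<open>Atrunc\<close>, which is also what the
  shift adds on the left. Only the penalties remain.\<close>

lemma excess_Atrunc_le_penalty:
  assumes \<psi>: "\<psi> \<in> S"
  shows "(\<integral>\<^sup>+ x. ennreal \<tau> * ennreal_powr (excess_dist (Se x) S) \<beta> * indicator (Atrunc \<psi> k) x \<partial>sample \<mu> n)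
    \<le> ennreal (1 / real n) * (\<Sum>i<n. \<integral>\<^sup>+ x. \<integral>\<^sup>+ y. penalty x i y \<partial>\<mu> \<partial>sample \<mu> n)"
proof -
  interpret S: prob_space "sample \<mu> n" by (rule prob_space_sample)
  let ?k = "2 * real k" and ?P = "sample \<mu> n" and ?A = "Atrunc \<psi> k"
  let ?B = "\<lambda>x i y. ennreal (indicator ?A (x(i := y)) * (W \<psi> (x(i := y)) - W \<psi> x) + ?k)"
  note [measurable] = meas_excess
  have pen [measurable]: "(\<lambda>(x, y). penalty x i y) \<in> borel_measurable (?P \<Otimes>\<^sub>M \<mu>)" if "i < n" for i
    using measurable_penalty[OF that] by (simp add: split_beta')
  have B [measurable]: "(\<lambda>(x, y). ?B x i y) \<in> borel_measurable (?P \<Otimes>\<^sub>M \<mu>)" if "i < n" for i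
  proof -
    note [measurable] = measurable_update[OF that]
    show ?thesis unfolding split_beta' by measurable
  qed
  have m: "(\<lambda>x. \<integral>\<^sup>+ y. (?B x i y * indicator ?A x + penalty x i y) \<partial>\<mu>) \<in> borel_measurable ?P" if "i < n" for i
  proof -
    have "(\<lambda>(x, y). ?B x i y * indicator ?A x + penalty x i y) \<in> borel_measurable (?P \<Otimes>\<^sub>M \<mu>)"
      using B[OF that] pen[OF that] unfolding split_beta' by measurable
    then show ?thesis by (rule borel_measurable_nn_integral)
  qed
  have "(\<integral>\<^sup>+ x. ennreal \<tau> * ennreal_powr (excess_dist (Se x) S) \<beta> * indicator ?A x \<partial>?P) + ennreal ?k * emeasure ?P ?A
      = (\<integral>\<^sup>+ x. (ennreal \<tau> * ennreal_powr (excess_dist (Se x) S) \<beta> + ennreal ?k) * indicator ?A x \<partial>?P)"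
    by (simp add: distrib_right nn_integral_add nn_integral_cmult_indicator)
  also have "\<dots> \<le> (\<integral>\<^sup>+ x. ennreal (1 / real n) * (\<Sum>i<n. \<integral>\<^sup>+ y. (?B x i y * indicator ?A x + penalty x i y) \<partial>\<mu>) \<partial>?P)"
  proof (rule nn_integral_mono_AE)
    show "AE x in ?P. (ennreal \<tau> * ennreal_powr (excess_dist (Se x) S) \<beta> + ennreal ?k) * indicator ?A x
        \<le> ennreal (1 / real n) * (\<Sum>i<n. \<integral>\<^sup>+ y. (?B x i y * indicator ?A x + penalty x i y) \<partial>\<mu>)"
      using AE_regular AE_update_minimizers
    proof eventually_elim
      case (elim x)
      show ?case
        using excess_le_penalty[OF \<psi> _ elim(1), of k] elim(2) by (cases "x \<in> ?A") auto
    qed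
  qed
  also have "\<dots> = ennreal (1 / real n) * (\<Sum>i<n. (\<integral>\<^sup>+ x. \<integral>\<^sup>+ y. (?B x i y * indicator ?A x + penalty x i y) \<partial>\<mu> \<partial>?P))"
    by (rule nn_integral_cmult_sum) (simp add: m)
  also have "\<dots> = ennreal (1 / real n) * (\<Sum>i<n. ennreal ?k * emeasure ?P ?A + (\<integral>\<^sup>+ x. \<integral>\<^sup>+ y. penalty x i y \<partial>\<mu> \<partial>?P))"
  proof (intro arg_cong2[where f = "(*)"] sum.cong refl)
    fix i assume "i \<in> {..<n}"
    then have i: "i < n" by simp
    have "(\<integral>\<^sup>+ x. \<integral>\<^sup>+ y. (?B x i y * indicator ?A x + penalty x i y) \<partial>\<mu> \<partial>?P)
        = (\<integral>\<^sup>+ x. (\<integral>\<^sup>+ y. ?B x i y * indicator ?A x \<partial>\<mu>) + (\<integral>\<^sup>+ y. penalty x i y \<partial>\<mu>) \<partial>?P)"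
    proof (rule nn_integral_cong)
      fix x assume x: "x \<in> space ?P"
      have "(\<lambda>y. ?B x i y) \<in> borel_measurable \<mu>" "(\<lambda>y. penalty x i y) \<in> borel_measurable \<mu>"
        using measurable_Pair2[OF B[OF i] x] measurable_Pair2[OF pen[OF i] x] by simp_all
      then show "(\<integral>\<^sup>+ y. (?B x i y * indicator ?A x + penalty x i y) \<partial>\<mu>)
          = (\<integral>\<^sup>+ y. ?B x i y * indicator ?A x \<partial>\<mu>) + (\<integral>\<^sup>+ y. penalty x i y \<partial>\<mu>)"
        by (intro nn_integral_add) auto
    qed
    also have "\<dots> = (\<integral>\<^sup>+ x. \<integral>\<^sup>+ y. ?B x i y * indicator ?A x \<partial>\<mu> \<partial>?P) + (\<integral>\<^sup>+ x. \<integral>\<^sup>+ y. penalty x i y \<partial>\<mu> \<partial>?P)"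
    proof (rule nn_integral_add)
      show "(\<lambda>x. \<integral>\<^sup>+ y. penalty x i y \<partial>\<mu>) \<in> borel_measurable ?P"
        by (rule borel_measurable_nn_integral[OF pen[OF i]])
      have "(\<lambda>(x, y). ?B x i y * indicator ?A x) \<in> borel_measurable (?P \<Otimes>\<^sub>M \<mu>)"
        using B[OF i] unfolding split_beta' by measurable
      then show "(\<lambda>x. \<integral>\<^sup>+ y. ?B x i y * indicator ?A x \<partial>\<mu>) \<in> borel_measurable ?P"
        by (rule borel_measurable_nn_integral)
    qed
    also have "(\<integral>\<^sup>+ x. \<integral>\<^sup>+ y. ?B x i y * indicator ?A x \<partial>\<mu> \<partial>?P) = ennreal ?k * emeasure ?P ?A"
      by (intro integral_exchange_truncated i) (auto simp: Atrunc_def[of \<psi> k])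
    finally show "(\<integral>\<^sup>+ x. \<integral>\<^sup>+ y. (?B x i y * indicator ?A x + penalty x i y) \<partial>\<mu> \<partial>?P)
        = ennreal ?k * emeasure ?P ?A + (\<integral>\<^sup>+ x. \<integral>\<^sup>+ y. penalty x i y \<partial>\<mu> \<partial>?P)" .
  qed
  also have "\<dots> = ennreal (1 / real n) * (of_nat n * (ennreal ?k * emeasure ?P ?A))
      + ennreal (1 / real n) * (\<Sum>i<n. \<integral>\<^sup>+ x. \<integral>\<^sup>+ y. penalty x i y \<partial>\<mu> \<partial>?P)"
    by (simp add: sum.distrib distrib_left)
  also have "ennreal (1 / real n) * (of_nat n * (ennreal ?k * emeasure ?P ?A)) = ennreal ?k * emeasure ?P ?A"
    using n_pos by (simp add: ennreal_of_nat_eq_real_of_nat mult.assoc[symmetric] ennreal_mult[symmetric])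
  finally have "ennreal ?k * emeasure ?P ?A + (\<integral>\<^sup>+ x. ennreal \<tau> * ennreal_powr (excess_dist (Se x) S) \<beta> * indicator ?A x \<partial>?P)
     \<le> ennreal ?k * emeasure ?P ?A + ennreal (1 / real n) * (\<Sum>i<n. \<integral>\<^sup>+ x. \<integral>\<^sup>+ y. penalty x i y \<partial>\<mu> \<partial>?P)"
    by (simp add: add.commute)
  \<comment> \<open>Cancellation of a summand in \<open>ennreal\<close> requires it to be
    finite.\<close>
  moreover have "ennreal ?k * emeasure ?P ?A \<noteq> \<infinity>"
    by (simp add: ennreal_mult_eq_top_iff S.emeasure_eq_measure)
  ultimately show ?thesis
    by (simp add: ennreal_add_left_cancel_le)
qed

text \<open>The bound on \<open>Atrunc\<close> is uniform in the level, and the levels increase to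
  the good set: monotone convergence.\<close>

lemma excess_le_mean_penalty:
  "(\<integral>\<^sup>+ x. ennreal \<tau> * ennreal_powr (excess_dist (Se x) S) \<beta> * indicator A x \<partial>sample \<mu> n)
    \<le> ennreal (1 / real n) * (\<Sum>i<n. \<integral>\<^sup>+ x. \<integral>\<^sup>+ y. penalty x i y \<partial>\<mu> \<partial>sample \<mu> n)"
proof -
  obtain \<psi> where \<psi>: "\<psi> \<in> S" using S_nonempty by auto
  note [measurable] = meas_excess
  let ?f = "\<lambda>k x. ennreal \<tau> * ennreal_powr (excess_dist (Se x) S) \<beta> * indicator (Atrunc \<psi> k) x"
  have inc: "incseq ?f"
    by (auto simp: incseq_def le_fun_def Atrunc_def indicator_def)
  have "(SUP k. ?f k x) = ennreal \<tau> * ennreal_powr (excess_dist (Se x) S) \<beta> * indicator A x" for x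
  proof (cases "x \<in> A")
    case True
    obtain k where "\<bar>W \<psi> x\<bar> \<le> real k" using real_arch_simple by blast
    then have "?f k x = ennreal \<tau> * ennreal_powr (excess_dist (Se x) S) \<beta> * indicator A x"
      using True by (simp add: Atrunc_def)
    then show ?thesis
      using True by (intro antisym SUP_least SUP_upper2[of k]) (auto simp: indicator_def)
  qed (auto simp: Atrunc_def)
  then have "(\<integral>\<^sup>+ x. ennreal \<tau> * ennreal_powr (excess_dist (Se x) S) \<beta> * indicator A x \<partial>sample \<mu> n)
      = (\<integral>\<^sup>+ x. (SUP k. ?f k x) \<partial>sample \<mu> n)"
    by simp
  also have "\<dots> = (SUP k. \<integral>\<^sup>+ x. ?f k x \<partial>sample \<mu> n)"
    by (intro nn_integral_monotone_convergence_SUP inc) measurable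
  also have "\<dots> \<le> ennreal (1 / real n) * (\<Sum>i<n. \<integral>\<^sup>+ x. \<integral>\<^sup>+ y. penalty x i y \<partial>\<mu> \<partial>sample \<mu> n)"
    by (intro SUP_least excess_Atrunc_le_penalty \<psi>)
  finally show ?thesis .
qed

end

section \<open>Moment bounds\<close>

lemma ennreal_power2_le_imp_le:
  fixes u :: ennreal
  assumes "u\<^sup>2 \<le> ennreal (b\<^sup>2)" "0 \<le> b"
  shows "u \<le> ennreal b"
proof (cases u)
  case (real r)
  then have "r\<^sup>2 \<le> b\<^sup>2" using assms by (simp add: ennreal_power)
  then have "r \<le> b" using assms(2) by (rule power2_le_imp_le)
  then show ?thesis using real by (simp add: ennreal_leI)
next
  case top
  then show ?thesis using assms by (simp add: power2_eq_square top_unique)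
qed

context erm_sample begin

abbreviation "Q \<equiv> sample \<mu> n \<Otimes>\<^sub>M \<mu>"
abbreviation "p \<equiv> measure (sample \<mu> n) (space (sample \<mu> n) - A)"

lemma nn_integral_component_pair:
  assumes i: "i < n" and g[measurable]: "case_prod g \<in> borel_measurable (\<mu> \<Otimes>\<^sub>M \<mu>)"
  shows "(\<integral>\<^sup>+ w. g (fst w i) (snd w) \<partial>Q) = (\<integral>\<^sup>+ w. case_prod g w \<partial>(\<mu> \<Otimes>\<^sub>M \<mu>))"
proof -
  have "(\<lambda>w. (fst w i, snd w)) \<in> Q \<rightarrow>\<^sub>M \<mu> \<Otimes>\<^sub>M \<mu>"
    by (rule measurable_Pair[OF measurable_compose[OF measurable_fst measurable_sample_component[OF i]] measurable_snd])
  from measurable_compose[OF this g]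
  have "(\<integral>\<^sup>+ w. g (fst w i) (snd w) \<partial>Q) = (\<integral>\<^sup>+ x. \<integral>\<^sup>+ y. g (x i) y \<partial>\<mu> \<partial>sample \<mu> n)"
    by (subst nn_integral_fst[symmetric]) auto
  also have "\<dots> = (\<integral>\<^sup>+ u. \<integral>\<^sup>+ y. g u y \<partial>\<mu> \<partial>\<mu>)"
    by (intro nn_integral_sample_component i borel_measurable_nn_integral g)
  also have "\<dots> = (\<integral>\<^sup>+ w. case_prod g w \<partial>(\<mu> \<Otimes>\<^sub>M \<mu>))"
    using nn_integral_fst[OF g] by simp
  finally show ?thesis .
qed

text \<open>The modified sample has the same law as the original one, by invariance under the
  exchange, so it leaves the good set with probability \<open>p\<close>. This is the origin of the
  square root of \<open>p\<close>.\<close>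

lemma escape_Cauchy_Schwarz:
  assumes i: "i < n" and g[measurable]: "g \<in> borel_measurable Q"
    and le: "(\<integral>\<^sup>+ w. (g w)\<^sup>2 \<partial>Q) \<le> ennreal (b\<^sup>2)" and b: "0 \<le> b"
  shows "(\<integral>\<^sup>+ w. indicator (space (sample \<mu> n) - A) ((fst w)(i := snd w)) * g w \<partial>Q) \<le> ennreal (sqrt p * b)"
proof -
  interpret S: prob_space "sample \<mu> n" by (rule prob_space_sample)
  let ?E = "space (sample \<mu> n) - A"
  note [measurable] = measurable_update[OF i]
  have "(\<integral>\<^sup>+ w. (indicator ?E ((fst w)(i := snd w)))\<^sup>2 \<partial>Q) = (\<integral>\<^sup>+ w. indicator ?E (fst (resample_swap i w)) \<partial>Q)"
    by (intro nn_integral_cong) (auto simp: resample_swap_def indicator_def split: prod.splits)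
  also have "\<dots> = (\<integral>\<^sup>+ w. indicator ?E (fst w) \<partial>Q)"
    by (rule nn_integral_resample_swap[OF i]) measurable
  also have "\<dots> = (\<integral>\<^sup>+ x. \<integral>\<^sup>+ y. indicator ?E x \<partial>\<mu> \<partial>sample \<mu> n)"
    by (subst nn_integral_fst[symmetric]) auto
  also have "\<dots> = ennreal p"
    by (simp add: emeasure_space_1 S.emeasure_eq_measure)
  finally have E: "(\<integral>\<^sup>+ w. (indicator ?E ((fst w)(i := snd w)))\<^sup>2 \<partial>Q) = ennreal p" .
  have "(\<integral>\<^sup>+ w. indicator ?E ((fst w)(i := snd w)) * g w \<partial>Q)\<^sup>2
      \<le> (\<integral>\<^sup>+ w. (indicator ?E ((fst w)(i := snd w)))\<^sup>2 \<partial>Q) * (\<integral>\<^sup>+ w. (g w)\<^sup>2 \<partial>Q)"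
    by (rule Cauchy_Schwarz_nn_integral) measurable
  also have "\<dots> \<le> ennreal p * ennreal (b\<^sup>2)"
    unfolding E by (intro mult_left_mono le) simp
  also have "\<dots> = ennreal ((sqrt p * b)\<^sup>2)"
    by (simp add: power_mult_distrib ennreal_mult)
  finally show ?thesis
    by (rule ennreal_power2_le_imp_le) (use b in simp)
qed

text \<open>If \<open>a\<close> vanishes almost everywhere then so does \<open>abar\<close>, and the
  self-bounding inequality leaves distance 0 on almost every good sample.\<close>

lemma excess_zero:
  assumes "AE w in \<mu> \<Otimes>\<^sub>M \<mu>. case_prod a w = 0"
  shows "(\<integral>\<^sup>+ x. ennreal_powr (excess_dist (Se x) S) \<beta> \<partial>uniform_measure (sample \<mu> n) A) = 0"
proof -
  interpret PP: pair_prob_space \<mu> \<mu> ..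
  note [measurable] = meas_excess
  have "AE u in \<mu>. AE y in \<mu>. a u y = 0"
    using PP.AE_pair[OF assms] by simp
  then have "AE x in sample \<mu> n. \<forall>i<n. AE y in \<mu>. a (x i) y = 0"
    by (rule AE_sample_component)
  with AE_regular
  have "AE x in sample \<mu> n. ennreal_powr (excess_dist (Se x) S) \<beta> * indicator A x = 0"
  proof eventually_elim
    case (elim x)
    show ?case
    proof (cases "x \<in> A")
      case True
      have "(\<integral>y. a (x i) y \<partial>\<mu>) = 0" if "i < n" for i
        using elim(2) that by (intro integral_eq_zero_AE) auto
      then have "abar x = 0" by (simp add: abar_def)
      have "infdist \<phi> S powr \<beta> = 0" if "\<phi> \<in> Se x" for \<phi>
      proof -
        have "\<tau> * infdist \<phi> S powr \<beta> \<le> 0"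
          using infdist_powr_self_bound[OF True elim(1) that] \<open>abar x = 0\<close> by simp
        then show ?thesis using tau_pos by (simp add: mult_le_0_iff)
      qed
      then have "ennreal_powr (excess_dist (Se x) S) \<beta> \<le> 0"
        using alpha_pos beta_gt_alpha by (intro ennreal_powr_excess_dist_le) auto
      then show ?thesis by simp
    qed simp
  qed
  then have "(\<integral>\<^sup>+ x. ennreal_powr (excess_dist (Se x) S) \<beta> * indicator A x \<partial>sample \<mu> n) = 0"
    by (subst nn_integral_0_iff_AE) auto
  then show ?thesis
    by (subst nn_integral_uniform_measure) auto
qed

end

text \<open>The nondegenerate case; \<open>N\<close> will be the psi_1 norm of \<open>a\<close>, and
  every moment below is measured in units of \<open>N\<close>.\<close>

locale erm_sample_exp = erm_sample +
  fixes N :: real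
  assumes N_pos: "0 < N"
    and exp_moment: "(\<integral>\<^sup>+ w. ennreal (exp (case_prod a w / N)) \<partial>(\<mu> \<Otimes>\<^sub>M \<mu>)) \<le> 2"
begin

lemma exp_component: "i < n \<Longrightarrow> (\<integral>\<^sup>+ w. ennreal (exp (a (fst w i) (snd w) / N)) \<partial>Q) \<le> 2"
  using nn_integral_component_pair[of i "\<lambda>u y. ennreal (exp (a u y / N))"] exp_moment
  by (simp add: split_beta')

text \<open>The stability term is a constant times the power \<open>1 + s\<close> of
  \<open>a\<close>, to which \<open>powr_le_exp\<close> applies after division by
  \<open>N\<close>.\<close>

lemma stab_le_exp:
  "stab u y \<le> (2 / (real n * \<tau>)) powr s * N powr (1 + s) * (1 + s) powr (1 + s) * exp (- (1 + s)) * exp (a u y / N)"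
proof -
  have a: "a u y = N * (a u y / N)" using N_pos by simp
  have "stab u y = (2 / (real n * \<tau>)) powr s * a u y powr (1 + s)"
  proof -
    have "(2 * a u y / (real n * \<tau>)) powr s = (2 / (real n * \<tau>)) powr s * a u y powr s"
      using a_nonneg n_pos tau_pos by (subst powr_mult[symmetric]) auto
    then show ?thesis
      using a_nonneg[of u y] by (cases "a u y = 0") (simp_all add: stab_def powr_add)
  qed
  also have "a u y powr (1 + s) = N powr (1 + s) * (a u y / N) powr (1 + s)"
    using a_nonneg N_pos by (subst powr_mult[symmetric]) auto
  also have "(2 / (real n * \<tau>)) powr s * \<dots> \<le> (2 / (real n * \<tau>)) powr s * (N powr (1 + s) *
      ((1 + s) powr (1 + s) * exp (- (1 + s)) * exp (a u y / N)))"
    using a_nonneg N_pos s_pos by (intro mult_left_mono powr_le_exp) auto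
  finally show ?thesis by (simp only: mult.assoc)
qed

lemma nn_integral_stab_le:
  assumes i: "i < n"
  shows "(\<integral>\<^sup>+ w. ennreal (stab (fst w i) (snd w)) \<partial>Q)
    \<le> ennreal (2 * ((2 / (real n * \<tau>)) powr s * N powr (1 + s) * (1 + s) powr (1 + s) * exp (- (1 + s))))"
    (is "_ \<le> ennreal (2 * ?C)")
proof -
  note [measurable] = measurable_a_component[OF i]
  have "(\<integral>\<^sup>+ w. ennreal (stab (fst w i) (snd w)) \<partial>Q)
      \<le> (\<integral>\<^sup>+ w. ennreal ?C * ennreal (exp (a (fst w i) (snd w) / N)) \<partial>Q)"
  proof (rule nn_integral_mono)
    fix w :: "(nat \<Rightarrow> 'a) \<times> 'a"
    have "ennreal (stab (fst w i) (snd w)) \<le> ennreal (?C * exp (a (fst w i) (snd w) / N))"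
      by (intro ennreal_leI stab_le_exp)
    then show "ennreal (stab (fst w i) (snd w)) \<le> ennreal ?C * ennreal (exp (a (fst w i) (snd w) / N))"
      by (simp only: ennreal_mult'' exp_ge_zero)
  qed
  also have "\<dots> = ennreal ?C * (\<integral>\<^sup>+ w. ennreal (exp (a (fst w i) (snd w) / N)) \<partial>Q)"
    by (rule nn_integral_cmult) measurable
  also have "\<dots> \<le> ennreal ?C * 2"
    by (intro mult_left_mono exp_component i) simp
  also have "\<dots> = 2 * ennreal ?C"
    by (rule mult.commute)
  also have "\<dots> = ennreal (2 * ?C)"
    by (simp only: ennreal_mult' zero_le_numeral ennreal_numeral)
  finally show ?thesis .
qed

text \<open>The second moment of \<open>a\<close> is at most \<open>N^2\<close>: by
  \<open>square_le_exp_minus_one\<close> it is bounded by \<open>N^2\<close> times an exponential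
  moment reduced by 1. Adding \<open>N^2\<close> to both sides avoids subtraction in
  \<open>ennreal\<close>.\<close>

lemma nn_integral_escape_le:
  assumes i: "i < n"
  shows "(\<integral>\<^sup>+ w. escape (fst w) i (snd w) \<partial>Q) \<le> ennreal (sqrt p * N)"
proof -
  interpret PS: prob_space Q
    by (rule prob_space_pair[OF prob_space_sample prob_space_axioms])
  note [measurable] = measurable_a_component[OF i]
  have "(\<integral>\<^sup>+ w. (ennreal (a (fst w i) (snd w)))\<^sup>2 \<partial>Q) + ennreal (N\<^sup>2)
      = (\<integral>\<^sup>+ w. (ennreal (a (fst w i) (snd w)))\<^sup>2 + ennreal (N\<^sup>2) \<partial>Q)"
    by (subst nn_integral_add) (auto simp: PS.emeasure_space_1)
  also have "\<dots> \<le> (\<integral>\<^sup>+ w. ennreal (N\<^sup>2) * ennreal (exp (a (fst w i) (snd w) / N)) \<partial>Q)"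
  proof (rule nn_integral_mono)
    fix w :: "(nat \<Rightarrow> 'a) \<times> 'a"
    let ?a = "a (fst w i) (snd w)"
    have "(?a / N)\<^sup>2 \<le> exp (?a / N) - 1"
      using a_nonneg N_pos by (intro square_le_exp_minus_one) auto
    then have "N\<^sup>2 * ((?a / N)\<^sup>2 + 1) \<le> N\<^sup>2 * exp (?a / N)"
      by (intro mult_left_mono) auto
    then have "?a\<^sup>2 + N\<^sup>2 \<le> N\<^sup>2 * exp (?a / N)"
      using N_pos by (simp add: power_divide distrib_left)
    then have "ennreal (?a\<^sup>2 + N\<^sup>2) \<le> ennreal (N\<^sup>2 * exp (?a / N))"
      by (rule ennreal_leI)
    then show "(ennreal ?a)\<^sup>2 + ennreal (N\<^sup>2) \<le> ennreal (N\<^sup>2) * ennreal (exp (?a / N))"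
      using a_nonneg by (simp add: ennreal_power ennreal_mult)
  qed
  also have "\<dots> = ennreal (N\<^sup>2) * (\<integral>\<^sup>+ w. ennreal (exp (a (fst w i) (snd w) / N)) \<partial>Q)"
    by (rule nn_integral_cmult) measurable
  also have "\<dots> \<le> ennreal (N\<^sup>2) * 2"
    by (intro mult_left_mono exp_component i) simp
  also have "\<dots> = ennreal (N\<^sup>2) + ennreal (N\<^sup>2)"
    by (simp add: mult_2_right)
  finally have "(\<integral>\<^sup>+ w. (ennreal (a (fst w i) (snd w)))\<^sup>2 \<partial>Q) \<le> ennreal (N\<^sup>2)"
    by (simp add: ennreal_add_left_cancel_le add.commute)
  from escape_Cauchy_Schwarz[OF i _ this] N_pos
  show ?thesis by (simp add: escape_def mult.commute)
qed

text \<open>Jensen's inequality, by integrating the tangent line of \<open>exp\<close> at \<open>abar x / N\<close>.\<close>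

lemma exp_abar_le:
  assumes x: "regular x"
  shows "ennreal (exp (abar x / N)) \<le> ennreal (1 / real n) * (\<Sum>i<n. \<integral>\<^sup>+ y. ennreal (exp (a (x i) y / N)) \<partial>\<mu>)"
proof -
  define c where "c = abar x / N"
  let ?f = "\<lambda>i y. exp c * (1 + a (x i) y / N - c)"
  have a_int: "integrable \<mu> (a (x i))" if "i < n" for i
    using x that by (simp add: regular_def)
  then have int: "integrable \<mu> (?f i)" if "i < n" for i
    using that by simp
  have "(\<Sum>i<n. \<integral>y. ?f i y \<partial>\<mu>) = (\<Sum>i<n. exp c * (1 + (\<integral>y. a (x i) y \<partial>\<mu>) / N - c))"
    using a_int by (intro sum.cong) (auto simp: prob_space)
  also have "\<dots> = exp c * (real n + (\<Sum>i<n. \<integral>y. a (x i) y \<partial>\<mu>) / N - real n * c)"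
    by (simp add: sum_distrib_left[symmetric] sum.distrib sum_subtractf sum_divide_distrib)
  \<comment> \<open>By the choice of \<open>c\<close> the linear part of the tangent averages to 0,
    which leaves exactly \<open>exp c\<close>.\<close>
  also have "(\<Sum>i<n. \<integral>y. a (x i) y \<partial>\<mu>) / N = real n * c"
    using n_pos by (simp add: c_def abar_def)
  finally have sum: "exp c = 1 / real n * (\<Sum>i<n. \<integral>y. ?f i y \<partial>\<mu>)"
    using n_pos by simp
  have "ennreal (exp c) = ennreal (1 / real n * (\<Sum>i<n. \<integral>y. ?f i y \<partial>\<mu>))"
    using sum by (rule arg_cong)
  also have "\<dots> = ennreal (1 / real n) * ennreal (\<Sum>i<n. \<integral>y. ?f i y \<partial>\<mu>)"
    by (rule ennreal_mult') simp
  also have "\<dots> \<le> ennreal (1 / real n) * (\<Sum>i<n. \<integral>\<^sup>+ y. ennreal (?f i y) \<partial>\<mu>)"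
    using int by (intro mult_left_mono ennreal_sum_integral_le) auto
  also have "\<dots> \<le> ennreal (1 / real n) * (\<Sum>i<n. \<integral>\<^sup>+ y. ennreal (exp (a (x i) y / N)) \<partial>\<mu>)"
  proof (intro mult_left_mono sum_mono nn_integral_mono ennreal_leI)
    fix i y
    have "exp c * (1 + (a (x i) y / N - c)) \<le> exp c * exp (a (x i) y / N - c)"
      by (intro mult_left_mono exp_ge_add_one_self) simp
    then show "?f i y \<le> exp (a (x i) y / N)"
      by (simp add: exp_diff add_diff_eq)
  qed simp
  finally show ?thesis by (simp add: c_def)
qed

lemma nn_integral_exp_abar_le: "(\<integral>\<^sup>+ w. ennreal (exp (abar (fst w) / N)) \<partial>Q) \<le> 2"
proof -
  have m: "(\<lambda>(x, y). ennreal (exp (a (x i) y / N))) \<in> borel_measurable Q" if "i < n" for i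
  proof -
    note [measurable] = measurable_a_component[OF that]
    show ?thesis unfolding split_beta' by measurable
  qed
  have m': "(\<lambda>x. \<integral>\<^sup>+ y. ennreal (exp (a (x i) y / N)) \<partial>\<mu>) \<in> borel_measurable (sample \<mu> n)" if "i < n" for i
    by (rule borel_measurable_nn_integral[OF m[OF that]])
  have "(\<integral>\<^sup>+ w. ennreal (exp (abar (fst w) / N)) \<partial>Q) = (\<integral>\<^sup>+ x. ennreal (exp (abar x / N)) \<partial>sample \<mu> n)"
    by (subst nn_integral_fst[symmetric]) (auto simp: emeasure_space_1)
  also have "\<dots> \<le> (\<integral>\<^sup>+ x. ennreal (1 / real n) * (\<Sum>i<n. \<integral>\<^sup>+ y. ennreal (exp (a (x i) y / N)) \<partial>\<mu>) \<partial>sample \<mu> n)"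
    using AE_regular by (intro nn_integral_mono_AE) (auto elim: eventually_mono intro: exp_abar_le)
  also have "\<dots> = ennreal (1 / real n) * (\<Sum>i<n. \<integral>\<^sup>+ x. \<integral>\<^sup>+ y. ennreal (exp (a (x i) y / N)) \<partial>\<mu> \<partial>sample \<mu> n)"
    by (rule nn_integral_cmult_sum) (simp add: m')
  also have "\<dots> \<le> ennreal (1 / real n) * (\<Sum>i<n. 2)"
  proof (intro mult_left_mono sum_mono)
    fix i assume "i \<in> {..<n}"
    then have i: "i < n" by simp
    show "(\<integral>\<^sup>+ x. \<integral>\<^sup>+ y. ennreal (exp (a (x i) y / N)) \<partial>\<mu> \<partial>sample \<mu> n) \<le> 2"
      using nn_integral_fst[OF m[OF i]] exp_component[OF i] by (simp add: split_beta')
  qed simp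
  also have "\<dots> = (ennreal (1 / real n) * ennreal (real n)) * 2"
    by (simp add: ennreal_of_nat_eq_real_of_nat mult.assoc)
  also have "\<dots> = 2"
    using n_pos by (simp add: ennreal_mult[symmetric])
  finally show ?thesis .
qed

text \<open>After Cauchy-Schwarz a second moment of a product of \<open>a\<close> and a power of
  \<open>abar\<close> remains. These two depend on the same observation \<open>x i\<close>;
  \<open>square_powr_le_exp_mix\<close> separates them into exponentials, each of moment at most
  2.\<close>

lemma nn_integral_escape_abar_le:
  assumes i: "i < n" and M: "1 \<le> M" "4 * s \<le> M"
  shows "(\<integral>\<^sup>+ w. escape (fst w) i (snd w) * ennreal ((abar (fst w) / \<tau>) powr s) \<partial>Q)
    \<le> ennreal (sqrt p * (2 * M powr s * N powr (1 + s) / \<tau> powr s))"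
proof -
  note [measurable] = measurable_a_component[OF i]
  let ?g = "\<lambda>w. a (fst w i) (snd w) * (abar (fst w) / \<tau>) powr s"
  let ?b = "2 * M powr s * N powr (1 + s) / \<tau> powr s"
  have g0: "0 \<le> ?g w" for w by (simp add: a_nonneg)
  \<comment> \<open>The weights 3/4 and 1/4 give the mixture a mean of at most 2, so the second
    moment is at most \<open>2 * C\<close>, the square of \<open>?b\<close>.\<close>
  define C where "C = ?b\<^sup>2 / 2"
  have C0: "0 \<le> C" by (simp add: C_def)
  have "(\<integral>\<^sup>+ w. (ennreal (?g w))\<^sup>2 \<partial>Q)
      \<le> (\<integral>\<^sup>+ w. ennreal C * (ennreal (3/4) * ennreal (exp (a (fst w i) (snd w) / N)) + ennreal (1/4) * ennreal (exp (abar (fst w) / N))) \<partial>Q)"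
  proof (rule nn_integral_mono)
    fix w :: "(nat \<Rightarrow> 'a) \<times> 'a"
    define t where "t = a (fst w i) (snd w) / N"
    define u where "u = abar (fst w) / N"
    have t: "0 \<le> t" and u: "0 \<le> u" using N_pos by (simp_all add: t_def u_def a_nonneg abar_nonneg)
    have "?g w = N * t * ((N * u) / \<tau>) powr s"
      using N_pos by (simp add: t_def u_def)
    also have "\<dots> = N * t * (N powr s * u powr s / \<tau> powr s)"
      using N_pos u tau_pos by (simp add: powr_divide powr_mult)
    also have "\<dots> = N powr (1 + s) / \<tau> powr s * (t * u powr s)"
      using N_pos by (simp add: powr_add)
    finally have "(?g w)\<^sup>2 = (N powr (1 + s) / \<tau> powr s)\<^sup>2 * (t\<^sup>2 * (u powr s)\<^sup>2)"
      by (simp only: power_mult_distrib)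
    also have "(u powr s)\<^sup>2 = u powr (2 * s)"
      by (simp add: power2_eq_square powr_add[symmetric])
    also have "(N powr (1 + s) / \<tau> powr s)\<^sup>2 * (t\<^sup>2 * u powr (2 * s))
        \<le> (N powr (1 + s) / \<tau> powr s)\<^sup>2 * (2 * M powr (2 * s) * (3/4 * exp t + 1/4 * exp u))"
      by (intro mult_left_mono square_powr_le_exp_mix t u s_pos M) simp
    also have "M powr (2 * s) = (M powr s)\<^sup>2"
      by (simp add: power2_eq_square powr_add[symmetric])
    also have "(N powr (1 + s) / \<tau> powr s)\<^sup>2 * (2 * (M powr s)\<^sup>2 * (3/4 * exp t + 1/4 * exp u))
        = C * (3/4 * exp t + 1/4 * exp u)"
      by (simp add: C_def power_mult_distrib power_divide)
    finally have "ennreal ((?g w)\<^sup>2) \<le> ennreal (C * (3/4 * exp t + 1/4 * exp u))"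
      by (rule ennreal_leI)
    then show "(ennreal (?g w))\<^sup>2 \<le> ennreal C * (ennreal (3/4) * ennreal (exp (a (fst w i) (snd w) / N)) + ennreal (1/4) * ennreal (exp (abar (fst w) / N)))"
      using C0 g0[of w] by (simp only: ennreal_power ennreal_mult' ennreal_mult'' ennreal_plus exp_ge_zero t_def[symmetric] u_def[symmetric]
          mult_nonneg_nonneg divide_nonneg_pos zero_le_numeral zero_less_numeral zero_le_one)
  qed
  also have "\<dots> = ennreal C * (ennreal (3/4) * (\<integral>\<^sup>+ w. ennreal (exp (a (fst w i) (snd w) / N)) \<partial>Q)
      + ennreal (1/4) * (\<integral>\<^sup>+ w. ennreal (exp (abar (fst w) / N)) \<partial>Q))"
    by (simp add: nn_integral_cmult nn_integral_add)
  also have "\<dots> \<le> ennreal C * (ennreal (3/4) * ennreal 2 + ennreal (1/4) * ennreal 2)"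
    using exp_component[OF i] nn_integral_exp_abar_le by (intro mult_left_mono add_mono) auto
  also have "\<dots> = ennreal (?b\<^sup>2)"
  proof -
    have "ennreal (3/4) * ennreal 2 + ennreal (1/4) * ennreal 2 = ennreal (3/4 * 2 + 1/4 * 2)"
      by (simp only: ennreal_mult'[symmetric] ennreal_plus)
    then show ?thesis
      using C0 by (simp only: ennreal_mult'[symmetric]) (simp add: C_def)
  qed
  finally have "(\<integral>\<^sup>+ w. (ennreal (?g w))\<^sup>2 \<partial>Q) \<le> ennreal (?b\<^sup>2)" .
  from escape_Cauchy_Schwarz[OF i _ this] M
  have "(\<integral>\<^sup>+ w. indicator (space (sample \<mu> n) - A) ((fst w)(i := snd w)) * ennreal (?g w) \<partial>Q)
      \<le> ennreal (sqrt p * ?b)" by simp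
  then show ?thesis
    by (simp only: escape_def ennreal_mult'' powr_ge_zero mult_ac)
qed

lemma mean_penalty_le:
  assumes M: "1 \<le> M" "4 * s \<le> M"
  shows "ennreal (1 / real n) * (\<Sum>i<n. \<integral>\<^sup>+ x. \<integral>\<^sup>+ y. penalty x i y \<partial>\<mu> \<partial>sample \<mu> n)
    \<le> ennreal (2 * ((2 / (real n * \<tau>)) powr s * N powr (1 + s) * (1 + s) powr (1 + s) * exp (- (1 + s))))
      + ennreal (2 powr max 0 (\<alpha> - 1)) * (ennreal (sqrt p * (2 * M powr s * N powr (1 + s) / \<tau> powr s))
          + ennreal (sqrt p * N) * ennreal_powr (ediameter S) \<alpha>)"
    (is "_ \<le> ?T")
proof -
  have "(\<integral>\<^sup>+ x. \<integral>\<^sup>+ y. penalty x i y \<partial>\<mu> \<partial>sample \<mu> n) \<le> ?T" if i: "i < n" for i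
  proof -
    note [measurable] = measurable_penalty[OF i] measurable_escape[OF i] measurable_stab[OF i]
    have "(\<lambda>(x, y). penalty x i y) \<in> borel_measurable Q"
      unfolding split_beta' by measurable
    from nn_integral_fst[OF this]
    have "(\<integral>\<^sup>+ x. \<integral>\<^sup>+ y. penalty x i y \<partial>\<mu> \<partial>sample \<mu> n) = (\<integral>\<^sup>+ w. penalty (fst w) i (snd w) \<partial>Q)"
      by (simp add: split_beta')
    also have "\<dots> = (\<integral>\<^sup>+ w. ennreal (stab (fst w i) (snd w)) \<partial>Q) + ennreal (2 powr max 0 (\<alpha> - 1)) *
       ((\<integral>\<^sup>+ w. escape (fst w) i (snd w) * ennreal ((abar (fst w) / \<tau>) powr s) \<partial>Q)
        + (\<integral>\<^sup>+ w. escape (fst w) i (snd w) \<partial>Q) * ennreal_powr (ediameter S) \<alpha>)"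
      unfolding penalty_def by (simp add: nn_integral_add nn_integral_cmult nn_integral_multc)
    also have "\<dots> \<le> ?T"
      by (intro add_mono mult_left_mono mult_right_mono nn_integral_stab_le nn_integral_escape_le
          nn_integral_escape_abar_le i M) auto
    finally show ?thesis .
  qed
  then have "ennreal (1 / real n) * (\<Sum>i<n. \<integral>\<^sup>+ x. \<integral>\<^sup>+ y. penalty x i y \<partial>\<mu> \<partial>sample \<mu> n)
      \<le> ennreal (1 / real n) * (\<Sum>i<n. ?T)"
    by (intro mult_left_mono sum_mono) auto
  also have "\<dots> = (ennreal (1 / real n) * ennreal (real n)) * ?T"
    by (simp only: sum_constant card_lessThan ennreal_of_nat_eq_real_of_nat mult.assoc)
  also have "ennreal (1 / real n) * ennreal (real n) = 1"
    using n_pos by (simp add: ennreal_mult[symmetric])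
  finally show ?thesis by simp
qed

end

section \<open>The conditional bound\<close>

text \<open>Bookkeeping with \<open>D\<close> the power of the diameter, possibly infinite. The two
  equalities concern the other factors only, so \<open>D\<close> is merely multiplied and never
  cancelled.\<close>

lemma ennreal_combine_bounds:
  fixes q t1 m t2 t3 D Lr c1 m' Ls c2 sp :: ennreal
  assumes "q * t1 \<le> Lr * c1" "q * m * t2 = Lr * m' * c2 * sp" "q * m * t3 = Lr * m' * Ls * sp"
  shows "q * (t1 + m * (t2 + t3 * D)) \<le> Lr * (c1 + m' * (Ls * D + c2) * sp)"
proof -
  have "q * (t1 + m * (t2 + t3 * D)) = q * t1 + (q * m * t2 + (q * m * t3) * D)"
    by (simp add: distrib_left mult_ac)
  also have "\<dots> \<le> Lr * c1 + (Lr * m' * c2 * sp + (Lr * m' * Ls * sp) * D)"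
    unfolding assms(2,3) by (intro add_mono assms(1)) auto
  also have "\<dots> = Lr * (c1 + m' * (Ls * D + c2) * sp)"
    by (simp add: distrib_left distrib_right mult_ac add_ac)
  finally show ?thesis .
qed

context erm_sample_exp begin

text \<open>All powers of \<open>N\<close>, \<open>\<tau>\<close>, \<open>n\<close> and
  \<open>1 + s\<close> agree on both sides. With \<open>r = 1 + s\<close> what remains is
  \<open>4 * (2 / e)^r \<le> 4^r\<close>, true because \<open>2 \<le> e\<close> and
  \<open>r \<ge> 1\<close>.\<close>

lemma leading_constant_le:
  "4 / \<tau> * (2 * ((2 / (real n * \<tau>)) powr s * N powr (1 + s) * (1 + s) powr (1 + s) * exp (- (1 + s))))
    \<le> (N / \<tau>) powr (1 + s) * ((4 * (1 + s)) powr (1 + s) * real n powr (- s))"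
proof -
  define r where "r = 1 + s"
  have r: "1 \<le> r" "0 < r" using s_pos by (simp_all add: r_def)
  have tau_r: "\<tau> powr r = \<tau> * \<tau> powr s" and two_r: "2 powr r = 2 * 2 powr s"
    using tau_pos by (simp_all add: r_def powr_add)
  have "2 powr r \<le> exp 1 powr r"
    using exp_ge_add_one_self[of 1] r by (intro powr_mono2) auto
  then have "2 powr r * exp (- r) \<le> 1"
    by (simp add: powr_def exp_minus field_simps)
  moreover have "4 \<le> 4 powr r"
    using powr_mono[of 1 r 4] r by simp
  ultimately have "4 * (2 powr r * exp (- r)) \<le> 4 powr r * 1"
    by (intro mult_mono) auto
  then have const: "8 * 2 powr s * exp (- r) \<le> 4 powr r"
    by (simp add: two_r)
  have "4 / \<tau> * (2 * ((2 / (real n * \<tau>)) powr s * N powr r * r powr r * exp (- r)))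
      = (8 * 2 powr s * exp (- r)) * ((N / \<tau>) powr r * (r powr r * real n powr (- s)))"
    using tau_pos n_pos N_pos r
    by (simp add: powr_divide powr_mult tau_r powr_minus field_simps)
  also have "\<dots> \<le> 4 powr r * ((N / \<tau>) powr r * (r powr r * real n powr (- s)))"
    by (intro mult_right_mono const) auto
  also have "\<dots> = (N / \<tau>) powr r * ((4 * r) powr r * real n powr (- s))"
    using r by (simp add: powr_mult)
  finally show ?thesis by (simp only: r_def)
qed

text \<open>Conditioning divides by the probability \<open>1 - p\<close> of the good set. The
  resulting factor 4 is the summand 2 in the exponent of \<open>K\<close>; in the leading term it is
  absorbed by \<open>leading_constant_le\<close>.\<close>

lemma conditional_excess_le:
  assumes p_le: "p \<le> 3 / 4"
  shows "(\<integral>\<^sup>+ x. ennreal_powr (excess_dist (Se x) S) \<beta> \<partial>uniform_measure (sample \<mu> n) A)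
    \<le> ennreal ((N / \<tau>) powr (1 + s)) * (ennreal ((4 * (1 + s)) powr (1 + s) * real n powr (- s))
       + ennreal (2 powr (max 0 (\<alpha> - 1) + 2)) * (ennreal ((N / \<tau>) powr (- s)) * ennreal_powr (ediameter S) \<alpha>
           + ennreal (2 * (max (4 * s) 1) powr s)) * ennreal (sqrt p))"
    (is "_ \<le> ?RHS")
proof -
  interpret S: prob_space "sample \<mu> n" by (rule prob_space_sample)
  note [measurable] = meas_excess
  define M where "M = max (4 * s) 1"
  have M: "1 \<le> M" "4 * s \<le> M" by (simp_all add: M_def)
  define X where "X = (\<integral>\<^sup>+ x. ennreal_powr (excess_dist (Se x) S) \<beta> * indicator A x \<partial>sample \<mu> n)"
  let ?T = "ennreal (2 * ((2 / (real n * \<tau>)) powr s * N powr (1 + s) * (1 + s) powr (1 + s) * exp (- (1 + s))))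
      + ennreal (2 powr max 0 (\<alpha> - 1)) * (ennreal (sqrt p * (2 * M powr s * N powr (1 + s) / \<tau> powr s))
          + ennreal (sqrt p * N) * ennreal_powr (ediameter S) \<alpha>)"
  have "ennreal \<tau> * X = (\<integral>\<^sup>+ x. ennreal \<tau> * ennreal_powr (excess_dist (Se x) S) \<beta> * indicator A x \<partial>sample \<mu> n)"
    unfolding X_def mult.assoc by (rule nn_integral_cmult[symmetric]) measurable
  also have "\<dots> \<le> ?T"
    using excess_le_mean_penalty mean_penalty_le[OF M] by (rule order.trans)
  finally have X: "ennreal \<tau> * X \<le> ?T" .
  have P_A: "emeasure (sample \<mu> n) A = ennreal (1 - p)"
    using S.prob_compl[OF meas_A] by (simp add: S.emeasure_eq_measure)
  have "(\<integral>\<^sup>+ x. ennreal_powr (excess_dist (Se x) S) \<beta> \<partial>uniform_measure (sample \<mu> n) A) = X / ennreal (1 - p)"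
    unfolding X_def P_A[symmetric] by (rule nn_integral_uniform_measure) measurable
  also have "\<dots> = X * ennreal (inverse (1 - p))"
    unfolding divide_ennreal_def by (subst inverse_ennreal) (use p_le in auto)
  also have "\<dots> \<le> X * ennreal 4"
  proof (intro mult_left_mono ennreal_leI)
    show "inverse (1 - p) \<le> 4"
      using p_le le_imp_inverse_le[of "1 / 4" "1 - p"] by simp
  qed simp
  also have "\<dots> = X * ennreal (4 / \<tau> * \<tau>)"
    using tau_pos by simp
  also have "\<dots> = ennreal (4 / \<tau>) * (ennreal \<tau> * X)"
  proof -
    have "ennreal (4 / \<tau> * \<tau>) = ennreal (4 / \<tau>) * ennreal \<tau>"
      by (rule ennreal_mult') (use tau_pos in simp)
    then show ?thesis by (simp only: mult_ac)
  qed
  also have "\<dots> \<le> ennreal (4 / \<tau>) * ?T"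
    by (intro mult_left_mono X) simp
  also have "\<dots> \<le> ?RHS"
  proof (rule ennreal_combine_bounds)
    have q: "0 \<le> 4 / \<tau>" using tau_pos by simp
    show "ennreal (4 / \<tau>) * ennreal (2 * ((2 / (real n * \<tau>)) powr s * N powr (1 + s) * (1 + s) powr (1 + s) * exp (- (1 + s))))
        \<le> ennreal ((N / \<tau>) powr (1 + s)) * ennreal ((4 * (1 + s)) powr (1 + s) * real n powr (- s))"
      unfolding ennreal_mult'[OF q, symmetric] ennreal_mult'[OF powr_ge_zero, symmetric]
      by (rule ennreal_leI[OF leading_constant_le])
    have "4 / \<tau> * 2 powr max 0 (\<alpha> - 1) * (sqrt p * (2 * M powr s * N powr (1 + s) / \<tau> powr s))
        = (N / \<tau>) powr (1 + s) * 2 powr (max 0 (\<alpha> - 1) + 2) * (2 * M powr s) * sqrt p"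
      using tau_pos N_pos by (simp add: powr_divide powr_add)
    then show "ennreal (4 / \<tau>) * ennreal (2 powr max 0 (\<alpha> - 1)) * ennreal (sqrt p * (2 * M powr s * N powr (1 + s) / \<tau> powr s))
        = ennreal ((N / \<tau>) powr (1 + s)) * ennreal (2 powr (max 0 (\<alpha> - 1) + 2)) * ennreal (2 * max (4 * s) 1 powr s) * ennreal (sqrt p)"
      unfolding M_def[symmetric]
      by (simp only: ennreal_mult'[symmetric] q powr_ge_zero mult_nonneg_nonneg zero_le_numeral)
    \<comment> \<open>The diameter term carries only the first power of \<open>N / \<tau>\<close>;
      the negative power in \<open>K\<close> compensates for the common prefactor.\<close>
    have "(N / \<tau>) powr (1 + s) * (N / \<tau>) powr (- s) = N / \<tau>"
      using tau_pos N_pos by (simp add: powr_add[symmetric])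
    then have "4 / \<tau> * 2 powr max 0 (\<alpha> - 1) * (sqrt p * N)
        = ((N / \<tau>) powr (1 + s) * (N / \<tau>) powr (- s)) * 2 powr (max 0 (\<alpha> - 1) + 2) * sqrt p"
      by (simp add: powr_add)
    then have "4 / \<tau> * 2 powr max 0 (\<alpha> - 1) * (sqrt p * N)
        = (N / \<tau>) powr (1 + s) * 2 powr (max 0 (\<alpha> - 1) + 2) * (N / \<tau>) powr (- s) * sqrt p"
      by (simp only: mult_ac)
    then show "ennreal (4 / \<tau>) * ennreal (2 powr max 0 (\<alpha> - 1)) * ennreal (sqrt p * N)
        = ennreal ((N / \<tau>) powr (1 + s)) * ennreal (2 powr (max 0 (\<alpha> - 1) + 2)) * ennreal ((N / \<tau>) powr (- s)) * ennreal (sqrt p)"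
      by (simp only: ennreal_mult'[symmetric] q powr_ge_zero mult_nonneg_nonneg)
  qed
  finally show ?thesis .
qed

end

text \<open>Conditioning on the good set is integration against \<open>uniform_measure\<close>. Both
  sides are \<open>ennreal\<close>-valued, since the diameter of \<open>S\<close> and the excess
  distance may be infinite.\<close>

theorem lemma7:
  fixes \<mu> :: "'x::metric_space measure"
    and l :: "'m::metric_space \<Rightarrow> 'x \<Rightarrow> real"
    and R :: "'m \<Rightarrow> ereal"
    and J0 :: ereal and \<alpha> \<beta> \<tau> :: real
    and a :: "'x \<Rightarrow> 'x \<Rightarrow> real" and \<Upsilon> :: "'m set"
    and \<eta> \<kappa> \<iota> :: "nat \<Rightarrow> real" and n :: nat
  defines "J \<equiv> risk \<mu> l R"
    and "J_emp \<equiv> emp_risk l R"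
    and "S \<equiv> minimizers (risk \<mu> l R)"
    and "S_emp \<equiv> \<lambda>n x. minimizers (emp_risk l R n x)"
    and "\<A> \<equiv> good_set \<mu> l R \<tau> \<beta> J0 \<Upsilon>"
    and "p \<equiv> \<lambda>n. measure (sample \<mu> n) (space (sample \<mu> n) - good_set \<mu> l R \<tau> \<beta> J0 \<Upsilon> n)"
    and "norm_a \<equiv> psi1_norm (\<mu> \<Otimes>\<^sub>M \<mu>) (\<lambda>(x, y). a x y)"
  defines "L \<equiv> enn2real norm_a / \<tau>"
    and "c1 \<equiv> (4 * \<beta> / (\<beta> - \<alpha>)) powr (\<beta> / (\<beta> - \<alpha>))"
    and "c2 \<equiv> 2 * (max (4 * \<alpha> / (\<beta> - \<alpha>)) 1) powr (\<alpha> / (\<beta> - \<alpha>))"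
  defines "K \<equiv> ennreal (2 powr (max 0 (\<alpha> - 1) + 2))
                 * (ennreal (L powr (- \<alpha> / (\<beta> - \<alpha>))) * ennreal_powr (ediameter S) \<alpha> + ennreal c2)"
  assumes prob: "prob_space \<mu>"
    and borel: "sets \<mu> = sets borel"
    and support: "AE x in \<mu>. x \<in> measure_support \<mu>"
    and l_integrable: "\<And>\<phi>. integrable \<mu> (l \<phi>)"
    and R_not_MInf: "\<And>\<phi>. R \<phi> \<noteq> - \<infinity>"
    and meas_min_value: "\<And>n. n \<ge> 1 \<Longrightarrow> (\<lambda>x. min_value (J_emp n x)) \<in> borel_measurable (sample \<mu> n)"
    and meas_sup_risk: "\<And>n. n \<ge> 1 \<Longrightarrow> (\<lambda>x. SUP \<phi>\<in>S_emp n x. J \<phi>) \<in> borel_measurable (sample \<mu> n)"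
    and meas_tau_hat: "\<And>n. n \<ge> 1 \<Longrightarrow> (\<lambda>x. tau_hat \<mu> l R \<beta> J0 n x) \<in> borel_measurable (sample \<mu> n)"
    and meas_incl: "\<And>n. n \<ge> 1 \<Longrightarrow> {x \<in> space (sample \<mu> n). S_emp n x \<subseteq> \<Upsilon>} \<in> sets (sample \<mu> n)"
    and meas_excess: "\<And>n. n \<ge> 1 \<Longrightarrow> (\<lambda>x. excess_dist (S_emp n x) S) \<in> borel_measurable (sample \<mu> n)"
    and meas_a: "(\<lambda>(x, y). a x y) \<in> borel_measurable (\<mu> \<Otimes>\<^sub>M \<mu>)"
    and J_proper: "proper J"
    and S_nonempty: "S \<noteq> {}"
    and emp_minimizers_exist: "\<And>n. n \<ge> 1 \<Longrightarrow> AE x in sample \<mu> n. proper (J_emp n x) \<and> S_emp n x \<noteq> {}"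
    and emp_minimizers_measurable: "\<And>n. n \<ge> 1 \<Longrightarrow> \<exists>\<phi>_hat \<in> sample \<mu> n \<rightarrow>\<^sub>M borel. AE x in sample \<mu> n. \<phi>_hat x \<in> S_emp n x"
    and J0_gt: "min_value J < J0"
    and beta_ge_1: "\<beta> \<ge> 1"
    and tau_pos: "\<tau> > 0"
    and margin: "\<And>\<phi>. J \<phi> \<le> J0 \<Longrightarrow> ereal (\<tau> * infdist \<phi> S powr \<beta>) \<le> J \<phi> - min_value J"
    and eta_range: "\<And>n. \<eta> n \<in> {0..1}"
    and eta_lim: "\<eta> \<longlonglongrightarrow> 0"
    and eta_prob: "\<And>n. n \<ge> 1 \<Longrightarrow>
           measure (sample \<mu> n) {x \<in> space (sample \<mu> n). (SUP \<phi>\<in>S_emp n x. J \<phi>) > J0} \<le> \<eta> n"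
    and kappa_range: "\<And>n. \<kappa> n \<in> {0..1}"
    and kappa_lim: "\<kappa> \<longlonglongrightarrow> 0"
    and kappa_prob: "\<And>n. n \<ge> 1 \<Longrightarrow>
           measure (sample \<mu> n) {x \<in> space (sample \<mu> n). tau_hat \<mu> l R \<beta> J0 n x < ereal (\<tau> / 2)} \<le> \<kappa> n"
    and alpha_pos: "\<alpha> > 0"
    and a_pseudometric: "pseudometric a"
    and a_norm_finite: "norm_a < \<infinity>"
    and S_subset: "S \<subseteq> \<Upsilon>"
    and increments: "AE x in \<mu>. AE y in \<mu>. \<forall>\<phi>\<in>\<Upsilon>. \<forall>\<psi>\<in>\<Upsilon>.
           l \<phi> x - l \<psi> x - l \<phi> y + l \<psi> y \<le> a x y * dist \<phi> \<psi> powr \<alpha>"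
    and iota_range: "\<And>n. \<iota> n \<in> {0..1}"
    and iota_lim: "\<iota> \<longlonglongrightarrow> 0"
    and iota_prob: "\<And>n. n \<ge> 1 \<Longrightarrow>
           measure (sample \<mu> n) {x \<in> space (sample \<mu> n). \<not> S_emp n x \<subseteq> \<Upsilon>} \<le> \<iota> n"
    and beta_gt_alpha: "\<beta> > \<alpha>"
    and n_ge_1: "n \<ge> 1"
    and p_le: "p n \<le> 3 / 4"
  shows "(\<integral>\<^sup>+ x. ennreal_powr (excess_dist (S_emp n x) S) \<beta> \<partial>uniform_measure (sample \<mu> n) (\<A> n))
           \<le> ennreal (L powr (\<beta> / (\<beta> - \<alpha>)))
              * (ennreal (c1 * real n powr (- \<alpha> / (\<beta> - \<alpha>))) + K * ennreal (sqrt (p n)))"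
proof -
  interpret prob_space \<mu> by (rule prob)
  let ?a = "\<lambda>(x, y). a x y" and ?\<mu>2 = "\<mu> \<Otimes>\<^sub>M \<mu>"
  note [measurable] = meas_a
  have a_nonneg: "0 \<le> a x y" for x y
    using a_pseudometric by (simp add: pseudometric_def)
  define N where "N = enn2real norm_a"
  have N: "norm_a = ennreal N" "0 \<le> N"
    using a_norm_finite by (simp_all add: N_def)
  \<comment> \<open>Any constant above the norm provides an exponential moment and thus a finite
    mean; \<open>N + 1\<close> does so even for \<open>N = 0\<close>.\<close>
  have "psi1_norm ?\<mu>2 ?a < ennreal (N + 1)"
    using N unfolding norm_a_def by (simp add: ennreal_less_iff)
  then obtain c where c: "0 < c" "(\<integral>\<^sup>+ w. ennreal (exp (\<bar>?a w\<bar> / c)) \<partial>?\<mu>2) \<le> 2"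
    by (rule psi1_norm_witness)
  have a_finite: "(\<integral>\<^sup>+ w. ennreal (?a w) \<partial>?\<mu>2) < \<infinity>"
  proof -
    have "(\<integral>\<^sup>+ w. ennreal (?a w) \<partial>?\<mu>2) \<le> (\<integral>\<^sup>+ w. ennreal \<bar>?a w\<bar> \<partial>?\<mu>2)"
      by (intro nn_integral_mono ennreal_leI abs_ge_self)
    also have "\<dots> \<le> ennreal (2 * c)"
      by (intro nn_integral_abs_le_exp_moment c meas_a)
    also have "\<dots> < \<infinity>" by (simp add: ennreal_less_top)
    finally show ?thesis .
  qed
  have good: "good_set \<mu> l R \<tau> \<beta> J0 \<Upsilon> n \<in> sets (sample \<mu> n)"
  proof -
    note [measurable] = meas_sup_risk[OF n_ge_1, unfolded S_emp_def J_def] meas_tau_hat[OF n_ge_1]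
      meas_incl[OF n_ge_1, unfolded S_emp_def]
    show ?thesis unfolding good_set_def by measurable
  qed
  interpret E: erm_sample \<mu> l R J0 \<alpha> \<beta> \<tau> a \<Upsilon> n
  proof
    show "AE x in sample \<mu> n. minimizers (emp_risk l R n x) \<noteq> {}"
      using emp_minimizers_exist[OF n_ge_1] by (auto simp: S_emp_def elim: eventually_mono)
  qed (use support l_integrable R_not_MInf meas_min_value[OF n_ge_1] good meas_excess[OF n_ge_1] meas_a J_proper
      S_nonempty tau_pos margin alpha_pos a_nonneg a_finite S_subset increments beta_gt_alpha n_ge_1
      in \<open>auto simp: J_def J_emp_def S_def S_emp_def\<close>)
  show ?thesis
  proof (cases "N = 0")
    \<comment> \<open>Here \<open>L\<close> is 0, and so is the right-hand side even for infinite
      \<open>K\<close>; the conditional expectation has to vanish exactly.\<close>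
    case True
    then have "psi1_norm ?\<mu>2 ?a = 0" using N by (simp add: norm_a_def)
    then have "AE w in ?\<mu>2. ?a w = 0"
      by (intro psi1_norm_eq_0_AE) auto
    from E.excess_zero[OF this] show ?thesis
      by (simp add: S_emp_def S_def \<A>_def)
  next
    case False
    interpret E: erm_sample_exp \<mu> l R J0 \<alpha> \<beta> \<tau> a \<Upsilon> n N
    proof
      show "0 < N" using False N by simp
      then have "(\<integral>\<^sup>+ w. ennreal (exp (\<bar>?a w\<bar> / N)) \<partial>?\<mu>2) \<le> 2"
        using N by (intro nn_integral_exp_psi1_norm_le) (auto simp: norm_a_def)
      moreover have "\<bar>?a w\<bar> = ?a w" for w
        using a_nonneg by (cases w) simp
      ultimately show "(\<integral>\<^sup>+ w. ennreal (exp (?a w / N)) \<partial>?\<mu>2) \<le> 2"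
        by simp
    qed
    \<comment> \<open>Translates the exponents and constants of the statement into
      \<open>s = \<alpha> / (\<beta> - \<alpha>)\<close>.\<close>
    have exponents: "\<beta> / (\<beta> - \<alpha>) = 1 + \<alpha> / (\<beta> - \<alpha>)" "- \<alpha> / (\<beta> - \<alpha>) = - (\<alpha> / (\<beta> - \<alpha>))"
        "4 * \<alpha> / (\<beta> - \<alpha>) = 4 * (\<alpha> / (\<beta> - \<alpha>))" "4 * \<beta> / (\<beta> - \<alpha>) = 4 * (1 + \<alpha> / (\<beta> - \<alpha>))"
      using beta_gt_alpha by (simp_all add: field_simps)
    show ?thesis
      using E.conditional_excess_le p_le
      unfolding S_emp_def S_def \<A>_def p_def K_def c1_def c2_def L_def N_def[symmetric] exponents
      by simp
  qed
qed

end
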